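(* Let $A\in\mathcal V$, $\gamma>0$, and let $\mathcal A\subseteq\mathcal V$ be such that $\sqrt{\gamma}\,A\in\overline{\mathcal A}$ (closure in $\mathcal V$). Then for every $\beta\in \big(L^2([T_1,T_2]^2)\big)^p$, $$\sup_{A'\in C^{\gamma}_{\mathcal A}(A)} R_{A'}(\beta)=\tfrac12 R_+(\beta)+\left(\gamma-\tfrac12\right)R_\Delta(\beta),$$ where $R_+(\beta)=R_A(\beta)+R_O(\beta)$ and $R_\Delta(\beta)=R_A(\beta)-R_O(\beta)$.
   Context: Let $T_1<T_2$, $p\ge 1$, and let $L^2([T_1,T_2])$ be the real Hilbert space of square integrable functions with respect to Lebesgue measure. For a Hilbert space $H$, $H^k$ carries the inner product $\langle x,y\rangle_{H^k}=\sum_{i=1}^k\langle x_i,y_i\rangle_H$. Fix a probability space $(\Omega,\mathcal F,\mathbb P)$. $\mathcal V$ is the Hilbert space of random elements $U=(U(1),\dots,U(p+1))$ of $L^2([T_1,T_2])^{p+1}$ (measurable from $\mathcal F$ to the Borel sigma-algebra) with $\|U\|_{\mathcal V}^2=\sum_{i=1}^{p+1}\int_{[T_1,T_2]}\mathbb E[U_t(i)^2]\,dt<\infty$. Let $\mathcal T:D(\mathcal T)\to L^2([T_1,T_2])^{p+1}$, $D(\mathcal T)\subseteq L^2([T_1,T_2])^{p+1}$, be an operator (not necessarily bounded) such that $\mathsf{Range}(I-\mathcal T)$ is dense in $L^2([T_1,T_2])^{p+1}$ and is a Lusin space, and such that $\mathcal S:=(I-\mathcal T)^{-1}$ exists and is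 bounded and linear (and injective) on $\mathsf{Range}(I-\mathcal T)$. $\mathcal S$ also denotes its bounded linear extension to all of $L^2([T_1,T_2])^{p+1}$. Put $\tilde{\mathcal V}=\{U\in\mathcal V:\mathbb P(U\in\mathsf{Range}(I-\mathcal T))=1\}$. Fix noise $\epsilon\in\tilde{\mathcal V}$ with $\mathbb E[\epsilon]=0$ (Bochner integral). For $A\in\mathcal V$, $(\Omega_A,\mathcal F_A,\mathbb P_A)$ (with expectation $\mathbb E_A$) is an extension of $(\Omega,\mathcal F,\mathbb P)$ containing a copy $\epsilon_A$ of $\epsilon$ (same law) such that $\epsilon_A$ and $A$ are independent. The environment with shift $A$ is $(Y^A,X^A)=\mathcal S(A+\epsilon_A)$, where $Y^A$ is the first component and $X^A=(X^A(1),\dots,X^A(p))$ the remaining $p$ components. The observational environment, denoted by $O$, is the case of zero shift: $(Y^O,X^O)=\mathcal S(\epsilon_O)$. For $A\in\mathcal V$ and $\beta=(\beta(1),\dots,\beta(p))\in (L^2([T_1,T_2]^2))^p$ the risk is $$R_A(\beta)=\mathbb E_A\left[\int_{[T_1,T_2]}\left(Y^A_t-\int_{[T_1,T_2]}\sum_{i=1}^p(\beta(i))(t,\tau)X^A_\tau(i)\,d\tau\right)^2dt\right],$$ and $R_O(\beta)$ is the same expression for $(Y^O,X^O)$. For $A\in\mathcal V$, $K_A(s,t)$ is the $(p+1)\times(p+1)$ matrix with $(i,j)$ entry $\mathbb E[A_s(i)A_t(j)]$. For $\mathcal A\subseteq\mathcal V$ and $\gamma>0$, $$C^\gamma_{\mathcal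 A}(A)=\Big\{A'\in\mathcal A:\int_{[T_1,T_2]^2}g(s)K_{A'}(s,t)g(t)^T\,ds\,dt\le\gamma\int_{[T_1,T_2]^2}g(s)K_A(s,t)g(t)^T\,ds\,dt\ \ \forall g\in L^2([T_1,T_2])^{p+1}\Big\},$$ where $g(s)$ is regarded as a row vector.
   Formalization: The hypothesis that √γA lies in the closure of 𝒜 is replaced by: √γA lies in the closure of C^γ_𝒜(A). As stated the claim fails: for A ≠ 0 and 𝒜 = {cA : c > √γ} the set C^γ_𝒜(A) is empty. The new hypothesis holds if √γA ∈ 𝒜, in particular if 𝒜 is closed. *)

theory Defs
  imports "HOL-Probability.Probability"
begin

definition square_integrable :: "(real \<Rightarrow> real) \<Rightarrow> bool" where
  "square_integrable f \<longleftrightarrow> f \<in> borel_measurable lborel \<and> integrable lborel (\<lambda>x. (f x)\<^sup>2)"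

lemma square_integrable_measurable [measurable_dest]:
  "square_integrable f \<Longrightarrow> f \<in> borel_measurable borel"
  by (simp add: square_integrable_def)

lemma square_integrable_zero [simp]: "square_integrable (\<lambda>x. 0)"
  by (simp add: square_integrable_def)

lemma square_integrable_mult:
  assumes "square_integrable f" "square_integrable g"
  shows "integrable lborel (\<lambda>x. f x * g x)"
proof (rule Bochner_Integration.integrable_bound)
  show "integrable lborel (\<lambda>x. (f x)\<^sup>2 + (g x)\<^sup>2)"
    using assms by (auto simp: square_integrable_def)
  show "(\<lambda>x. f x * g x) \<in> borel_measurable lborel"
    using assms by (auto simp: square_integrable_def)
  have "norm (a * b) \<le> norm (a\<^sup>2 + b\<^sup>2)" for a b :: real
  proof -
    have "0 \<le> (\<bar>a\<bar> - \<bar>b\<bar>)\<^sup>2" by simp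
    then have "2 * (\<bar>a\<bar> * \<bar>b\<bar>) \<le> a\<^sup>2 + b\<^sup>2"
      by (simp add: power2_diff)
    moreover have "0 \<le> \<bar>a\<bar> * \<bar>b\<bar>" by simp
    ultimately have "\<bar>a\<bar> * \<bar>b\<bar> \<le> a\<^sup>2 + b\<^sup>2" by linarith
    then show ?thesis by (simp add: abs_mult)
  qed
  then show "AE x in lborel. norm (f x * g x) \<le> norm ((f x)\<^sup>2 + (g x)\<^sup>2)"
    by simp
qed

lemma square_integrable_add [intro]:
  assumes "square_integrable f" "square_integrable g"
  shows "square_integrable (\<lambda>x. f x + g x)"
proof -
  have "integrable lborel (\<lambda>x. (f x)\<^sup>2 + (g x)\<^sup>2 + 2 * (f x * g x))"
    using assms square_integrable_mult[OF assms]
    by (intro Bochner_Integration.integrable_add integrable_mult_right)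
      (auto simp: square_integrable_def)
  then have "integrable lborel (\<lambda>x. (f x + g x)\<^sup>2)"
    by (simp add: power2_sum mult.assoc)
  moreover have "(\<lambda>x. f x + g x) \<in> borel_measurable lborel"
    using assms by (auto simp: square_integrable_def)
  ultimately show ?thesis
    by (simp add: square_integrable_def)
qed

lemma square_integrable_scale [intro]:
  "square_integrable f \<Longrightarrow> square_integrable (\<lambda>x. c * f x)"
  by (auto simp: square_integrable_def power_mult_distrib)

lemma square_integrable_diff [intro]:
  assumes "square_integrable f" "square_integrable g"
  shows "square_integrable (\<lambda>x. f x - g x)"
  using square_integrable_add[OF assms(1) square_integrable_scale[OF assms(2), of "-1"]] by simp

lemma square_integrable_bound:
  assumes "square_integrable g" "f \<in> borel_measurable borel" "\<And>x. \<bar>f x\<bar> \<le> \<bar>g x\<bar>"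
  shows "square_integrable f"
proof -
  have "integrable lborel (\<lambda>x. (f x)\<^sup>2)"
  proof (rule Bochner_Integration.integrable_bound)
    show "integrable lborel (\<lambda>x. (g x)\<^sup>2)" using assms by (simp add: square_integrable_def)
    show "(\<lambda>x. (f x)\<^sup>2) \<in> borel_measurable lborel" using assms by simp
    show "AE x in lborel. norm ((f x)\<^sup>2) \<le> norm ((g x)\<^sup>2)"
      using assms(3) by (simp add: abs_le_square_iff)
  qed
  then show ?thesis using assms by (simp add: square_integrable_def)
qed

definition L2_rel :: "(real \<Rightarrow> real) \<Rightarrow> (real \<Rightarrow> real) \<Rightarrow> bool" where
  "L2_rel f g \<longleftrightarrow> square_integrable f \<and> square_integrable g \<and> (AE x in lborel. f x = g x)"

lemma part_equivp_L2_rel: "part_equivp L2_rel"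
proof (rule part_equivpI)
  show "\<exists>f. L2_rel f f" by (rule exI[of _ "\<lambda>x. 0"]) (simp add: L2_rel_def)
  show "symp L2_rel" by (auto simp: symp_def L2_rel_def)
  show "transp L2_rel" by (auto simp: transp_def L2_rel_def elim: AE_mp)
qed

text \<open>
  \<open>L\<^sup>2(\<real>)\<close>. Restricting to Borel functions loses nothing, since every Lebesgue measurable function
  agrees almost everywhere with a Borel one.
\<close>

quotient_type L2 = "real \<Rightarrow> real" / partial: L2_rel
  by (rule part_equivp_L2_rel)

instantiation L2 :: real_inner
begin

lift_definition zero_L2 :: L2 is "\<lambda>x. 0" by (simp add: L2_rel_def)

lift_definition plus_L2 :: "L2 \<Rightarrow> L2 \<Rightarrow> L2" is "\<lambda>f g x. f x + g x"
  unfolding L2_rel_def by (auto elim: AE_mp)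

lift_definition minus_L2 :: "L2 \<Rightarrow> L2 \<Rightarrow> L2" is "\<lambda>f g x. f x - g x"
  unfolding L2_rel_def by (auto elim: AE_mp)

lift_definition uminus_L2 :: "L2 \<Rightarrow> L2" is "\<lambda>f x. - f x"
  unfolding L2_rel_def by (auto simp: square_integrable_def)

lift_definition scaleR_L2 :: "real \<Rightarrow> L2 \<Rightarrow> L2" is "\<lambda>c f x. c * f x"
  unfolding L2_rel_def by auto

lift_definition inner_L2 :: "L2 \<Rightarrow> L2 \<Rightarrow> real" is "\<lambda>f g. \<integral>x. f x * g x \<partial>lborel"
  unfolding L2_rel_def
  by (intro integral_cong_AE) (auto elim: AE_mp dest: square_integrable_measurable)

definition norm_L2 :: "L2 \<Rightarrow> real" where "norm_L2 x = sqrt (inner x x)"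
definition dist_L2 :: "L2 \<Rightarrow> L2 \<Rightarrow> real" where "dist_L2 x y = norm (x - y)"
definition sgn_L2 :: "L2 \<Rightarrow> L2" where "sgn_L2 x = inverse (norm x) *\<^sub>R x"
definition uniformity_L2 :: "(L2 \<times> L2) filter" where
  "uniformity_L2 = (INF e\<in>{0<..}. principal {(x, y). dist x y < e})"
definition open_L2 :: "L2 set \<Rightarrow> bool" where
  "open_L2 U \<longleftrightarrow> (\<forall>x\<in>U. \<forall>\<^sub>F (x', y) in uniformity. x' = x \<longrightarrow> y \<in> U)"

instance
proof
  fix x y z :: L2 and a b :: real and U :: "L2 set"
  show "x + y + z = x + (y + z)"
    by transfer (auto simp: L2_rel_def algebra_simps)
  show "x + y = y + x"
    by transfer (auto simp: L2_rel_def algebra_simps)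
  show "0 + x = x"
    by transfer (auto simp: L2_rel_def)
  show "- x + x = 0"
    by transfer (auto simp: L2_rel_def)
  show "x - y = x + - y"
    by transfer (auto simp: L2_rel_def)
  show "a *\<^sub>R (x + y) = a *\<^sub>R x + a *\<^sub>R y"
    by transfer (auto simp: L2_rel_def distrib_left)
  show "(a + b) *\<^sub>R x = a *\<^sub>R x + b *\<^sub>R x"
    by transfer (auto simp: L2_rel_def distrib_right)
  show "a *\<^sub>R b *\<^sub>R x = (a * b) *\<^sub>R x"
    by transfer (auto simp: L2_rel_def mult.assoc)
  show "1 *\<^sub>R x = x"
    by transfer (auto simp: L2_rel_def)
  show "inner x y = inner y x"
    by transfer (auto simp: L2_rel_def mult.commute)
  show "inner (x + y) z = inner x z + inner y z"
    by transfer (auto simp: L2_rel_def distrib_right square_integrable_mult)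
  show "inner (a *\<^sub>R x) y = a * inner x y"
    by transfer (auto simp: L2_rel_def mult.assoc)
  show "0 \<le> inner x x"
    by transfer (auto simp: L2_rel_def)
  show "(inner x x = 0) = (x = 0)"
  proof transfer
    fix f assume f: "L2_rel f f"
    then have "integrable lborel (\<lambda>x. f x * f x)"
      by (intro square_integrable_mult) (auto simp: L2_rel_def)
    from integral_nonneg_eq_0_iff_AE[OF this] f
    show "((\<integral>x. f x * f x \<partial>lborel) = 0) = L2_rel f (\<lambda>x. 0)"
      by (auto simp: L2_rel_def)
  qed
  show "norm x = sqrt (inner x x)" by (simp add: norm_L2_def)
  show "dist x y = norm (x - y)" by (simp add: dist_L2_def)
  show "sgn x = inverse (norm x) *\<^sub>R x" by (simp add: sgn_L2_def)
  show "uniformity = (INF e\<in>{0<..}. principal {(x::L2, y). dist x y < e})"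
    by (simp add: uniformity_L2_def)
  show "open U = (\<forall>x\<in>U. \<forall>\<^sub>F (x', y) in uniformity. x' = x \<longrightarrow> y \<in> U)"
    by (simp add: open_L2_def)
qed

end

lemma L2_cases:
  obtains g where "square_integrable g" "f = abs_L2 g"
  using Quotient3_abs_rep[OF Quotient3_L2, of f] Quotient3_rep_reflp[OF Quotient3_L2, of f]
  by (auto simp: L2_rel_def)

lemma abs_L2_eq_iff:
  "square_integrable f \<Longrightarrow> square_integrable g \<Longrightarrow> abs_L2 f = abs_L2 g \<longleftrightarrow> (AE x in lborel. f x = g x)"
  using Quotient3_rel[OF Quotient3_L2, of f g] by (auto simp: L2_rel_def)

lemma square_integrable_rep: "square_integrable (rep_L2 f)"
  using Quotient3_rep_reflp[OF Quotient3_L2, of f] by (simp add: L2_rel_def)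

lemma abs_rep_L2 [simp]: "abs_L2 (rep_L2 f) = f"
  by (rule Quotient3_abs_rep[OF Quotient3_L2])

lemma L2_rel_refl: "square_integrable f \<Longrightarrow> L2_rel f f"
  by (simp add: L2_rel_def)

lemma abs_L2_zero: "abs_L2 (\<lambda>x. 0) = 0"
  by (simp add: zero_L2_def)

lemma abs_L2_add:
  "square_integrable f \<Longrightarrow> square_integrable g \<Longrightarrow> abs_L2 (\<lambda>x. f x + g x) = abs_L2 f + abs_L2 g"
  by (simp add: plus_L2.abs_eq L2_rel_refl)

lemma abs_L2_diff:
  "square_integrable f \<Longrightarrow> square_integrable g \<Longrightarrow> abs_L2 (\<lambda>x. f x - g x) = abs_L2 f - abs_L2 g"
  by (simp add: minus_L2.abs_eq L2_rel_refl)

lemma abs_L2_scale: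
  "square_integrable f \<Longrightarrow> abs_L2 (\<lambda>x. c * f x) = c *\<^sub>R abs_L2 f"
  by (simp add: scaleR_L2.abs_eq L2_rel_refl)

lemma inner_abs_L2:
  "square_integrable f \<Longrightarrow> square_integrable g \<Longrightarrow> inner (abs_L2 f) (abs_L2 g) = (\<integral>x. f x * g x \<partial>lborel)"
  by (simp add: inner_L2.abs_eq L2_rel_refl)

lemma nn_integral_square_L2:
  assumes "square_integrable f"
  shows "(\<integral>\<^sup>+x. ennreal ((f x)\<^sup>2) \<partial>lborel) = ennreal ((norm (abs_L2 f))\<^sup>2)"
proof -
  have "(\<integral>x. (f x)\<^sup>2 \<partial>lborel) = (norm (abs_L2 f))\<^sup>2"
    by (simp only: power2_norm_eq_inner inner_abs_L2[OF assms assms]) (simp add: power2_eq_square)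
  then show ?thesis
    using assms by (subst nn_integral_eq_integral) (auto simp: square_integrable_def)
qed

lemma AE_summable_L2:
  assumes f: "\<And>n. square_integrable (f n)" and g: "\<And>n. square_integrable (g n)"
    and le: "\<And>n. norm (abs_L2 (f n) - abs_L2 (g n)) \<le> (1/2)^n"
  shows "AE x in lborel. summable (\<lambda>n. \<bar>f n x - g n x\<bar>)"
proof -
  have sq: "square_integrable (\<lambda>x. f n x - g n x)" for n
    using f g by auto
  define e where "e n x = 2^n * (f n x - g n x)\<^sup>2" for n x
  have e_meas [measurable]: "e n \<in> borel_measurable borel" for n
    unfolding e_def using square_integrable_measurable[OF sq[of n]] by measurable
  have int: "(\<integral>\<^sup>+x. ennreal (e n x) \<partial>lborel) \<le> ennreal ((1/2)^n)" for n
  proof -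
    have "(\<integral>\<^sup>+x. ennreal (e n x) \<partial>lborel) = ennreal (2^n) * (\<integral>\<^sup>+x. ennreal ((f n x - g n x)\<^sup>2) \<partial>lborel)"
      using square_integrable_measurable[OF sq[of n]]
      by (simp add: e_def ennreal_mult nn_integral_cmult)
    also have "\<dots> = ennreal (2^n * (norm (abs_L2 (f n) - abs_L2 (g n)))\<^sup>2)"
      by (simp add: nn_integral_square_L2[OF sq] abs_L2_diff f g ennreal_mult)
    also have "\<dots> \<le> ennreal (2^n * ((1/2)^n)\<^sup>2)"
      by (intro ennreal_leI mult_left_mono power_mono le) auto
    also have "2^n * ((1/2)^n)\<^sup>2 = ((1/2)^n :: real)"
      by (simp add: power2_eq_square power_divide)
    finally show ?thesis .
  qed
  have "(\<integral>\<^sup>+x. (\<Sum>n. ennreal (e n x)) \<partial>lborel) = (\<Sum>n. \<integral>\<^sup>+x. ennreal (e n x) \<partial>lborel)"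
    by (rule nn_integral_suminf) simp
  also have "\<dots> \<le> (\<Sum>n. ennreal ((1/2)^n))"
    by (intro suminf_le int) auto
  also have "\<dots> < \<infinity>"
    by (subst suminf_ennreal2) auto
  finally have "AE x in lborel. (\<Sum>n. ennreal (e n x)) \<noteq> \<infinity>"
    by (intro nn_integral_noteq_infinite) auto
  then show ?thesis
  proof eventually_elim
    fix x assume "(\<Sum>n. ennreal (e n x)) \<noteq> \<infinity>"
    then have "summable (\<lambda>n. e n x)"
      by (intro summable_suminf_not_top) (auto simp: e_def)
    then have *: "summable (\<lambda>n. (1/2)^n + e n x)"
      by (intro summable_add) auto
    show "summable (\<lambda>n. \<bar>f n x - g n x\<bar>)"
    proof (rule summable_comparison_test[OF _ *], intro exI[of _ 0] allI impI)
      fix n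
      define d where "d = \<bar>f n x - g n x\<bar>"
      have "0 \<le> (1 - 2^n * d)\<^sup>2" by simp
      then have "2 * (2^n * d) \<le> 1 + (2^n * d)\<^sup>2" by (simp add: power2_diff)
      moreover have "0 \<le> 2^n * d" by (simp add: d_def)
      ultimately have "2^n * d \<le> 1 + (2^n * d)\<^sup>2" by linarith
      then have "d \<le> (1 + (2^n * d)\<^sup>2) / 2^n" by (simp add: field_simps)
      also have "\<dots> = (1/2)^n + 2^n * d\<^sup>2"
        by (simp add: add_divide_distrib power_divide power2_eq_square)
      finally show "norm \<bar>f n x - g n x\<bar> \<le> (1/2)^n + e n x"
        by (simp add: d_def e_def)
    qed
  qed
qed

instance L2 :: banach
proof
  fix X :: "nat \<Rightarrow> L2" assume X: "Cauchy X"
  then have "\<forall>n. \<exists>N. \<forall>i\<ge>N. \<forall>j\<ge>N. dist (X i) (X j) < (1/2)^n"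
    by (intro allI metric_CauchyD) auto
  then obtain N where N: "\<And>n i j. N n \<le> i \<Longrightarrow> N n \<le> j \<Longrightarrow> dist (X i) (X j) < (1/2)^n"
    by metis
  define r where "r n = (\<Sum>i\<le>n. N i)" for n
  have r: "N n \<le> r m" if "n \<le> m" for n m
    unfolding r_def using that by (intro member_le_sum) auto
  define f where "f n = rep_L2 (X (r n))" for n
  have f: "square_integrable (f n)" and absf: "abs_L2 (f n) = X (r n)" for n
    by (auto simp: f_def square_integrable_rep)
  have fm [measurable]: "f n \<in> borel_measurable borel" for n
    using f by (rule square_integrable_measurable)
  have dist_f: "norm (abs_L2 (f m) - abs_L2 (f n)) \<le> (1/2)^n" if "n \<le> m" for n m
    using N[of n "r m" "r n"] r[OF that] r[of n n] by (simp add: absf dist_norm)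
  have "AE x in lborel. summable (\<lambda>n. \<bar>f (Suc n) x - f n x\<bar>)"
    by (intro AE_summable_L2 f dist_f) auto
  then have conv: "AE x in lborel. convergent (\<lambda>n. f n x)"
  proof eventually_elim
    fix x assume "summable (\<lambda>n. \<bar>f (Suc n) x - f n x\<bar>)"
    then have "summable (\<lambda>n. f (Suc n) x - f n x)" by (rule summable_rabs_cancel)
    then have "convergent (\<lambda>n. f n x - f 0 x)"
      by (simp add: summable_iff_convergent sum_lessThan_telescope[of "\<lambda>n. f n x"])
    then have "convergent (\<lambda>n. (f n x - f 0 x) + f 0 x)"
      by (intro convergent_add) (auto simp: convergent_const)
    then show "convergent (\<lambda>n. f n x)" by simp
  qed
  define F where "F x = lim (\<lambda>n. f n x)" for x
  have Fm [measurable]: "F \<in> borel_measurable borel"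
    unfolding F_def by (rule borel_measurable_lim_metric) simp
  have est: "(\<integral>\<^sup>+x. ennreal ((F x - f n x)\<^sup>2) \<partial>lborel) \<le> ennreal (((1/2)^n)\<^sup>2)" for n
  proof -
    have "(\<integral>\<^sup>+x. ennreal ((F x - f n x)\<^sup>2) \<partial>lborel)
        = (\<integral>\<^sup>+x. liminf (\<lambda>m. ennreal ((f m x - f n x)\<^sup>2)) \<partial>lborel)"
    proof (rule nn_integral_cong_AE)
      show "AE x in lborel. ennreal ((F x - f n x)\<^sup>2) = liminf (\<lambda>m. ennreal ((f m x - f n x)\<^sup>2))"
        using conv
      proof eventually_elim
        fix x assume "convergent (\<lambda>n. f n x)"
        then have "(\<lambda>m. f m x) \<longlonglongrightarrow> F x" by (simp add: F_def convergent_LIMSEQ_iff)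
        then have "(\<lambda>m. ennreal ((f m x - f n x)\<^sup>2)) \<longlonglongrightarrow> ennreal ((F x - f n x)\<^sup>2)"
          by (intro tendsto_ennrealI tendsto_intros)
        then show "ennreal ((F x - f n x)\<^sup>2) = liminf (\<lambda>m. ennreal ((f m x - f n x)\<^sup>2))"
          by (intro lim_imp_Liminf[symmetric]) auto
      qed
    qed
    also have "\<dots> \<le> liminf (\<lambda>m. \<integral>\<^sup>+x. ennreal ((f m x - f n x)\<^sup>2) \<partial>lborel)"
      by (rule nn_integral_liminf) simp
    also have "\<dots> \<le> limsup (\<lambda>m. \<integral>\<^sup>+x. ennreal ((f m x - f n x)\<^sup>2) \<partial>lborel)"
      by (rule Liminf_le_Limsup) simp
    also have "\<dots> \<le> ennreal (((1/2)^n)\<^sup>2)"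
    proof (rule Limsup_bounded, rule eventually_sequentiallyI)
      fix m assume "n \<le> m"
      have "(\<integral>\<^sup>+x. ennreal ((f m x - f n x)\<^sup>2) \<partial>lborel) = ennreal ((norm (abs_L2 (f m) - abs_L2 (f n)))\<^sup>2)"
        by (simp add: nn_integral_square_L2[OF square_integrable_diff[OF f f]] abs_L2_diff f)
      also have "\<dots> \<le> ennreal (((1/2)^n)\<^sup>2)"
        by (intro ennreal_leI power_mono dist_f \<open>n \<le> m\<close>) auto
      finally show "(\<integral>\<^sup>+x. ennreal ((f m x - f n x)\<^sup>2) \<partial>lborel) \<le> ennreal (((1/2)^n)\<^sup>2)" .
    qed
    finally show ?thesis .
  qed
  have sqd: "square_integrable (\<lambda>x. F x - f n x)" for n
    unfolding square_integrable_def
  proof (intro conjI integrableI_nonneg)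
    show "(\<integral>\<^sup>+x. ennreal ((F x - f n x)\<^sup>2) \<partial>lborel) < \<infinity>"
      using est[of n] by (rule order.strict_trans1) simp
  qed auto
  have sqF: "square_integrable F"
    using square_integrable_add[OF sqd[of 0] f[of 0]] by simp
  have Fle: "norm (X (r n) - abs_L2 F) \<le> (1/2)^n" for n
  proof -
    have "ennreal ((norm (abs_L2 F - abs_L2 (f n)))\<^sup>2) \<le> ennreal (((1/2)^n)\<^sup>2)"
      using est[of n] by (simp add: nn_integral_square_L2[OF sqd] abs_L2_diff sqF f)
    then have "(norm (abs_L2 F - abs_L2 (f n)))\<^sup>2 \<le> ((1/2)^n)\<^sup>2"
      by (subst (asm) ennreal_le_iff) auto
    then have "norm (abs_L2 F - abs_L2 (f n)) \<le> (1/2)^n"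
      by (rule power2_le_imp_le) simp
    then show ?thesis by (simp add: absf norm_minus_commute)
  qed
  have "X \<longlonglongrightarrow> abs_L2 F"
  proof (rule metric_LIMSEQ_I)
    fix e :: real assume "0 < e"
    then obtain n where n: "(1/2)^n < e / 2"
      using real_arch_pow_inv[of "e/2" "1/2"] by auto
    show "\<exists>no. \<forall>k\<ge>no. dist (X k) (abs_L2 F) < e"
    proof (intro exI allI impI)
      fix k assume "N n \<le> k"
      then have "dist (X k) (X (r n)) < (1/2)^n" using r[of n n] by (intro N) auto
      moreover have "dist (X (r n)) (abs_L2 F) \<le> (1/2)^n" using Fle[of n] by (simp add: dist_norm)
      ultimately show "dist (X k) (abs_L2 F) < e"
        using n dist_triangle[of "X k" "abs_L2 F" "X (r n)"] by linarith
    qed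
  qed
  then show "convergent X" by (auto simp: convergent_def)
qed

lemma ex_countable_subbasis_of_dense:
  fixes D :: "'a::metric_space set"
  assumes "countable D" and dense: "closure D = UNIV"
  shows "\<exists>B::'a set set. countable B \<and> open = generate_topology B"
proof (intro exI conjI)
  let ?B = "(\<lambda>(x, n). ball x (inverse (real (Suc n)))) ` (D \<times> (UNIV :: nat set))"
  show "countable ?B" using assms by auto
  show "open = generate_topology ?B"
  proof (intro ext iffI)
    fix U :: "'a set" assume "open U"
    have cov: "\<exists>S\<in>?B. x \<in> S \<and> S \<subseteq> U" if "x \<in> U" for x
    proof -
      obtain e where e: "e > 0" "ball x e \<subseteq> U"
        using \<open>open U\<close> \<open>x \<in> U\<close> open_contains_ball by blast
      obtain n where n: "inverse (real (Suc n)) < e / 2"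
        using e reals_Archimedean[of "e/2"] by auto
      obtain d where d: "d \<in> D" "dist d x < inverse (real (Suc n))"
        using dense closure_approachable[of x D]
        by (metis UNIV_I inverse_positive_iff_positive of_nat_0_less_iff zero_less_Suc)
      have "ball d (inverse (real (Suc n))) \<subseteq> ball x e"
      proof
        fix y assume "y \<in> ball d (inverse (real (Suc n)))"
        then show "y \<in> ball x e"
          using d n dist_triangle[of x y d] by (simp add: dist_commute)
      qed
      with d e show ?thesis by (intro bexI[of _ "ball d (inverse (real (Suc n)))"]) auto
    qed
    have "\<Union>{S \<in> B. S \<subseteq> U} = U" if "\<And>x. x \<in> U \<Longrightarrow> \<exists>S\<in>B. x \<in> S \<and> S \<subseteq> U" for B
      using that by fastforce
    from this[OF cov]
    have "\<Union>{S \<in> ?B. S \<subseteq> U} = U" .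
    moreover have "generate_topology ?B (\<Union>{S \<in> ?B. S \<subseteq> U})"
      by (rule generate_topology.UN, rule generate_topology.Basis) simp
    ultimately show "generate_topology ?B U" by simp
  next
    fix U assume "generate_topology ?B U"
    then show "open U" by induction auto
  qed
qed

definition L2_dense :: "L2 set" where
  "L2_dense = (\<lambda>l. \<Sum>(c, a, b)\<leftarrow>l. real_of_rat c *\<^sub>R
       abs_L2 (indicator {real_of_rat a<..real_of_rat b})) ` UNIV"

lemma countable_L2_dense: "countable L2_dense"
  by (simp add: L2_dense_def)

lemma L2_dense_add: "f \<in> L2_dense \<Longrightarrow> g \<in> L2_dense \<Longrightarrow> f + g \<in> L2_dense"
  unfolding L2_dense_def by (auto simp flip: sum_list_append map_append)

lemma L2_dense_scale:
  assumes "f \<in> L2_dense" shows "real_of_rat c *\<^sub>R f \<in> L2_dense"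
proof -
  from assms obtain l where l: "f = (\<Sum>(c, a, b)\<leftarrow>l. real_of_rat c *\<^sub>R
       abs_L2 (indicator {real_of_rat a<..real_of_rat b}))"
    by (auto simp: L2_dense_def)
  have "real_of_rat c *\<^sub>R f = (\<Sum>(c, a, b)\<leftarrow>map (\<lambda>(d, p). (c * d, p)) l. real_of_rat c *\<^sub>R
       abs_L2 (indicator {real_of_rat a<..real_of_rat b}))"
    unfolding l by (induction l) (auto simp: scaleR_add_right of_rat_mult)
  then show ?thesis unfolding L2_dense_def by blast
qed

lemma closure_L2_dense_add:
  assumes "f \<in> closure L2_dense" "g \<in> closure L2_dense"
  shows "f + g \<in> closure L2_dense"
proof -
  obtain F G where "\<And>n. F n \<in> L2_dense" "F \<longlonglongrightarrow> f" "\<And>n. G n \<in> L2_dense" "G \<longlonglongrightarrow> g"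
    using assms by (auto simp: closure_sequential)
  then show ?thesis
    unfolding closure_sequential
    by (intro exI[of _ "\<lambda>n. F n + G n"]) (auto intro: tendsto_add L2_dense_add)
qed

lemma closure_L2_dense_scale:
  assumes "f \<in> closure L2_dense" shows "c *\<^sub>R f \<in> closure L2_dense"
proof -
  obtain F where F: "\<And>n. F n \<in> L2_dense" "F \<longlonglongrightarrow> f"
    using assms by (auto simp: closure_sequential)
  have "\<exists>q. \<bar>real_of_rat q - c\<bar> < inverse (real (Suc n))" for n
  proof -
    obtain q where "c - inverse (real (Suc n)) < real_of_rat q" "real_of_rat q < c"
      using of_rat_dense[of "c - inverse (real (Suc n))" c] by auto
    then show ?thesis by (intro exI[of _ q]) auto
  qed
  then obtain q where q: "\<And>n. \<bar>real_of_rat (q n) - c\<bar> < inverse (real (Suc n))" by metis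
  have "(\<lambda>n. real_of_rat (q n) - c) \<longlonglongrightarrow> 0"
    by (rule Lim_null_comparison[OF _ LIMSEQ_inverse_real_of_nat])
      (use q in \<open>auto intro!: always_eventually less_imp_le simp del: of_nat_Suc\<close>)
  then have "(\<lambda>n. real_of_rat (q n)) \<longlonglongrightarrow> c" by (simp add: LIM_zero_iff)
  then show ?thesis
    unfolding closure_sequential
    by (intro exI[of _ "\<lambda>n. real_of_rat (q n) *\<^sub>R F n"]) (auto intro: tendsto_scaleR L2_dense_scale F)
qed

lemma closure_L2_dense_diff:
  "f \<in> closure L2_dense \<Longrightarrow> g \<in> closure L2_dense \<Longrightarrow> f - g \<in> closure L2_dense"
  using closure_L2_dense_add[of f "(-1) *\<^sub>R g"] closure_L2_dense_scale[of g "-1"] by simp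

lemma closure_L2_dense_limit:
  assumes "\<And>n. square_integrable (F n)" "square_integrable f" "\<And>n. abs_L2 (F n) \<in> closure L2_dense"
    and lim: "\<And>x. (\<lambda>n. F n x) \<longlonglongrightarrow> f x"
    and bound: "\<And>n x. \<bar>F n x\<bar> \<le> \<bar>f x\<bar>"
  shows "abs_L2 f \<in> closure L2_dense"
proof -
  have fm [measurable]: "f \<in> borel_measurable borel" "F n \<in> borel_measurable borel" for n
    using assms by (auto dest: square_integrable_measurable)
  have "(\<lambda>n. \<integral>x. (F n x - f x)\<^sup>2 \<partial>lborel) \<longlonglongrightarrow> (\<integral>x. 0 \<partial>(lborel :: real measure))"
  proof (rule integral_dominated_convergence[where w = "\<lambda>x. 4 * (f x)\<^sup>2"])
    show "integrable lborel (\<lambda>x. 4 * (f x)\<^sup>2)"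
      using assms(2) by (simp add: square_integrable_def)
    show "AE x in lborel. (\<lambda>n. (F n x - f x)\<^sup>2) \<longlonglongrightarrow> 0"
    proof (rule AE_I2)
      fix x
      have "(\<lambda>n. (F n x - f x)\<^sup>2) \<longlonglongrightarrow> (f x - f x)\<^sup>2"
        by (intro tendsto_intros lim)
      then show "(\<lambda>n. (F n x - f x)\<^sup>2) \<longlonglongrightarrow> 0" by simp
    qed
    show "AE x in lborel. norm ((F n x - f x)\<^sup>2) \<le> 4 * (f x)\<^sup>2" for n
    proof (rule AE_I2)
      fix x
      have "\<bar>F n x - f x\<bar> \<le> \<bar>2 * f x\<bar>" using bound[of n x] by linarith
      then have "(F n x - f x)\<^sup>2 \<le> (2 * f x)\<^sup>2" by (simp add: abs_le_square_iff)
      then show "norm ((F n x - f x)\<^sup>2) \<le> 4 * (f x)\<^sup>2" by (simp add: power_mult_distrib)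
    qed
  qed auto
  moreover have "(\<integral>x. (F n x - f x)\<^sup>2 \<partial>lborel) = (norm (abs_L2 (F n) - abs_L2 f))\<^sup>2" for n
    unfolding abs_L2_diff[OF assms(1,2), symmetric] power2_norm_eq_inner
    by (subst inner_abs_L2) (auto simp: assms power2_eq_square)
  ultimately have "(\<lambda>n. (norm (abs_L2 (F n) - abs_L2 f))\<^sup>2) \<longlonglongrightarrow> 0" by simp
  then have "(\<lambda>n. sqrt ((norm (abs_L2 (F n) - abs_L2 f))\<^sup>2)) \<longlonglongrightarrow> sqrt 0" by (rule tendsto_real_sqrt)
  then have "(\<lambda>n. abs_L2 (F n)) \<longlonglongrightarrow> abs_L2 f"
    by (simp add: tendsto_norm_zero_iff LIM_zero_iff)
  then show ?thesis
    by (rule closed_sequentially[OF closed_closure assms(3)])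
qed

lemma square_integrable_indicator:
  assumes "A \<in> sets borel" "emeasure lborel A < \<infinity>"
  shows "square_integrable (indicator A)"
proof -
  have "(\<lambda>x. (indicator A x :: real)\<^sup>2) = indicator A"
    by (auto simp: indicator_def)
  then show ?thesis using assms by (simp add: square_integrable_def)
qed

lemma emeasure_Int_Ioc: "emeasure lborel (A \<inter> {- real n<..real n}) < \<infinity>"
  by (rule order.strict_trans1[OF emeasure_mono[of _ "{- real n<..real n}"]]) auto

lemma closure_L2_dense_Ioc:
  "abs_L2 (indicator {a<..b :: real}) \<in> closure L2_dense"
proof -
  have rat: "abs_L2 (indicator {real_of_rat a<..real_of_rat b}) \<in> L2_dense" for a b
    unfolding L2_dense_def by (rule image_eqI[of _ _ "[(1, a, b)]"]) auto
  have "\<exists>p. a < real_of_rat p \<and> real_of_rat p < a + inverse (real (Suc n))" for n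
    using of_rat_dense[of a "a + inverse (real (Suc n))"] by simp
  then obtain p where "\<forall>n. a < real_of_rat (p n) \<and> real_of_rat (p n) < a + inverse (real (Suc n))"
    by (rule choice[OF allI, THEN exE])
  then have p: "a < real_of_rat (p n)" "real_of_rat (p n) < a + inverse (real (Suc n))" for n
    by blast+
  have "\<exists>q. b - inverse (real (Suc n)) < real_of_rat q \<and> real_of_rat q < b" for n
    using of_rat_dense[of "b - inverse (real (Suc n))" b] by simp
  then obtain q where "\<forall>n. b - inverse (real (Suc n)) < real_of_rat (q n) \<and> real_of_rat (q n) < b"
    by (rule choice[OF allI, THEN exE])
  then have q: "b - inverse (real (Suc n)) < real_of_rat (q n)" "real_of_rat (q n) < b" for n
    by blast+
  have sq: "square_integrable (indicator {a<..<b :: real})" for a b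
    by (rule square_integrable_indicator, simp, rule emeasure_bounded_finite, rule bounded_subset[of "{a..b}"]) auto
  have sq': "square_integrable (indicator {a<..b :: real})" for a b
    by (rule square_integrable_indicator, simp, rule emeasure_bounded_finite, rule bounded_subset[of "{a..b}"]) auto
  have "abs_L2 (indicator {a<..<b}) \<in> closure L2_dense"
  proof (rule closure_L2_dense_limit[where F = "\<lambda>n. indicator {real_of_rat (p n)<..real_of_rat (q n)}"])
    show "abs_L2 (indicator {real_of_rat (p n)<..real_of_rat (q n)}) \<in> closure L2_dense" for n
      by (rule subsetD[OF closure_subset rat])
    show "\<bar>indicator {real_of_rat (p n)<..real_of_rat (q n)} x\<bar> \<le> \<bar>indicator {a<..<b} x :: real\<bar>" for n x
      using p(1)[of n] q(2)[of n] by (auto simp: indicator_def)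
    fix x
    show "(\<lambda>n. indicator {real_of_rat (p n)<..real_of_rat (q n)} x :: real) \<longlonglongrightarrow> indicator {a<..<b} x"
    proof (cases "x \<in> {a<..<b}")
      case True
      then obtain N where N: "inverse (real (Suc N)) < min (x - a) (b - x)"
        using reals_Archimedean[of "min (x - a) (b - x)"] by auto
      have "\<forall>n\<ge>N. indicator {real_of_rat (p n)<..real_of_rat (q n)} x = (1::real)"
      proof (intro allI impI)
        fix n assume "N \<le> n"
        then have "inverse (real (Suc n)) \<le> inverse (real (Suc N))"
          by (intro le_imp_inverse_le) auto
        then have "real_of_rat (p n) < x" "x \<le> real_of_rat (q n)"
          using N p(2)[of n] q(1)[of n] by linarith+
        then show "indicator {real_of_rat (p n)<..real_of_rat (q n)} x = (1::real)"
          by (auto simp: indicator_def)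
      qed
      then have "\<forall>\<^sub>F n in sequentially. indicator {real_of_rat (p n)<..real_of_rat (q n)} x = (1::real)"
        by (auto simp: eventually_sequentially)
      then show ?thesis using True by (simp add: tendsto_eventually)
    next
      case False
      then have "indicator {real_of_rat (p n)<..real_of_rat (q n)} x = (0::real)" for n
        using p(1)[of n] q(2)[of n] by (auto simp: indicator_def)
      with False show ?thesis by simp
    qed
  qed (rule sq sq')+
  moreover have "abs_L2 (indicator {a<..<b}) = abs_L2 (indicator {a<..b})"
  proof (subst abs_L2_eq_iff[OF sq sq'])
    show "AE x in lborel. indicator {a<..<b} x = (indicator {a<..b} x :: real)"
      using AE_lborel_singleton[of b] by eventually_elim (auto simp: indicator_def)
  qed
  ultimately show ?thesis by simp
qed

lemma closure_L2_dense_bounded: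
  assumes "A \<in> sets borel"
  shows "abs_L2 (indicator (A \<inter> {- real n<..real n})) \<in> closure L2_dense"
proof -
  have sqA: "square_integrable (indicator (A \<inter> {- real n<..real n}))" if "A \<in> sets borel" for A
    using that by (intro square_integrable_indicator emeasure_Int_Ioc) auto
  have "Int_stable (range (\<lambda>(a, b). {a<..b :: real}))"
    by (auto simp: Int_stable_def)
  moreover have "range (\<lambda>(a, b). {a<..b :: real}) \<subseteq> Pow UNIV" by simp
  moreover have "A \<in> sigma_sets UNIV (range (\<lambda>(a, b). {a<..b :: real}))"
    using assms unfolding borel_sigma_sets_Ioc by simp
  ultimately show ?thesis
  proof (induction rule: sigma_sets_induct_disjoint)
    case (basic B)
    then obtain a b where "B = {a<..b}" by auto
    then have "B \<inter> {- real n<..real n} = {max a (- real n)<..min b (real n)}" by auto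
    then show ?case by (simp add: closure_L2_dense_Ioc)
  next
    case empty
    have "indicator ({} \<inter> {- real n<..real n}) = (\<lambda>x. 0::real)" by auto
    then show ?case using closure_L2_dense_Ioc[of 0 0] by simp
  next
    case (compl B)
    then have B: "B \<in> sets borel" by (simp add: borel_sigma_sets_Ioc)
    have eq: "indicator ((UNIV - B) \<inter> {- real n<..real n})
        = (\<lambda>x. indicator {- real n<..real n} x - indicator (B \<inter> {- real n<..real n}) x :: real)"
      by (auto simp: indicator_def fun_eq_iff)
    show ?case
      unfolding eq using sqA[of UNIV] sqA[OF B] compl(2)
      by (subst abs_L2_diff) (auto intro!: closure_L2_dense_diff closure_L2_dense_Ioc)
  next
    case (union B)
    from union(2) have B: "\<And>i. B i \<in> sets borel"
      unfolding borel_sigma_sets_Ioc by (simp add: range_subsetD)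
    have part: "abs_L2 (indicator ((\<Union>i<m. B i) \<inter> {- real n<..real n})) \<in> closure L2_dense" for m
    proof (induction m)
      case 0
      then show ?case
        using closure_L2_dense_Ioc[of 0 0] by simp (simp add: indicator_def[abs_def])
    next
      case (Suc m)
      have eq: "indicator ((\<Union>i<Suc m. B i) \<inter> {- real n<..real n})
        = (\<lambda>x. indicator ((\<Union>i<m. B i) \<inter> {- real n<..real n}) x + indicator (B m \<inter> {- real n<..real n}) x :: real)"
        (is "?l = ?r")
      proof
        fix x
        have "x \<notin> B i" if "x \<in> B m" "i < m" for i
          using disjoint_family_onD[OF union(1), of i m] that by auto
        then show "?l x = ?r x" by (auto simp: indicator_def less_Suc_eq)
      qed
      show ?case
        unfolding eq using sqA[of "\<Union>i<m. B i"] sqA[OF B] Suc union(3) B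
        by (subst abs_L2_diff abs_L2_add) (auto intro!: closure_L2_dense_add)
    qed
    show ?case
    proof (rule closure_L2_dense_limit[where F = "\<lambda>m. indicator ((\<Union>i<m. B i) \<inter> {- real n<..real n})"])
      show "(\<lambda>m. indicator ((\<Union>i<m. B i) \<inter> {- real n<..real n}) x :: real) \<longlonglongrightarrow>
          indicator ((\<Union>(range B)) \<inter> {- real n<..real n}) x" for x
      proof (cases "x \<in> \<Union>(range B)")
        case True
        then obtain j where j: "x \<in> B j" by auto
        then have "\<forall>m\<ge>Suc j. indicator ((\<Union>i<m. B i) \<inter> {- real n<..real n}) x =
            (indicator ((\<Union>(range B)) \<inter> {- real n<..real n}) x :: real)"
          by (auto simp: indicator_def)
        then show ?thesis by (intro tendsto_eventually) (auto simp: eventually_sequentially)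
      next
        case False
        then show ?thesis by (simp add: indicator_def)
      qed
      show "\<bar>indicator ((\<Union>i<m. B i) \<inter> {- real n<..real n}) x\<bar> \<le>
        \<bar>indicator ((\<Union>(range B)) \<inter> {- real n<..real n}) x :: real\<bar>" for m x
        by (auto simp: indicator_def)
    qed (use B part in \<open>auto intro!: sqA\<close>)
  qed
qed

lemma closure_L2_dense_nonneg:
  assumes "f \<in> borel_measurable borel" "\<And>x. 0 \<le> f x" "square_integrable f"
  shows "abs_L2 f \<in> closure L2_dense"
  using assms
proof (induction rule: borel_measurable_induct_real)
  case (set A)
  have sq: "square_integrable (indicator (A \<inter> {- real n<..real n}))" for n
    using set by (intro square_integrable_indicator emeasure_Int_Ioc) auto
  show ?case
  proof (rule closure_L2_dense_limit[where F = "\<lambda>n. indicator (A \<inter> {- real n<..real n})"])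
    fix x :: real
    obtain N where N: "\<bar>x\<bar> < real N" using reals_Archimedean2 by blast
    then have "\<forall>n\<ge>N. indicator (A \<inter> {- real n<..real n}) x = (indicator A x :: real)"
      by (auto simp: indicator_def)
    then show "(\<lambda>n. indicator (A \<inter> {- real n<..real n}) x :: real) \<longlonglongrightarrow> indicator A x"
      by (intro tendsto_eventually) (auto simp: eventually_sequentially)
  qed (use set sq closure_L2_dense_bounded in \<open>auto simp: indicator_def\<close>)
next
  case (mult u c)
  show ?case
  proof (cases "c = 0")
    case True
    have "abs_L2 (\<lambda>x. 0) \<in> closure L2_dense"
      using closure_L2_dense_Ioc[of 0 0] by simp (simp add: indicator_def[abs_def])
    with True show ?thesis by simp
  next
    case False
    have "square_integrable (\<lambda>x. inverse c * (c * u x))"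
      by (rule square_integrable_scale) fact
    moreover have "(\<lambda>x. inverse c * (c * u x)) = u" using False by auto
    ultimately have "square_integrable u" by simp
    with mult show ?thesis by (simp add: abs_L2_scale closure_L2_dense_scale)
  qed
next
  case (add u v)
  have "square_integrable u" "square_integrable v"
    using add by (auto intro!: square_integrable_bound[OF \<open>square_integrable (\<lambda>x. v x + u x)\<close>])
  with add show ?case by (simp add: abs_L2_add closure_L2_dense_add add.commute)
next
  case (seq U)
  have le: "U i x \<le> f x" for i x
  proof (rule incseq_le)
    show "incseq (\<lambda>i. U i x)" using \<open>incseq U\<close> by (auto simp: incseq_def le_fun_def)
    show "(\<lambda>i. U i x) \<longlonglongrightarrow> f x" by (rule seq) simp
  qed
  have sq: "square_integrable (U i)" for i
    by (rule square_integrable_bound[OF \<open>square_integrable f\<close>])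
      (use seq in \<open>auto intro: order.trans[OF le abs_ge_self]\<close>)
  show ?case
    by (rule closure_L2_dense_limit[where F = U])
      (use seq sq in \<open>auto intro: order.trans[OF le abs_ge_self]\<close>)
qed

lemma closure_L2_dense: "closure L2_dense = UNIV"
proof -
  have "f \<in> closure L2_dense" for f
  proof -
    obtain g where g: "square_integrable g" "f = abs_L2 g" by (rule L2_cases)
    have gm [measurable]: "g \<in> borel_measurable borel" using g by (auto dest: square_integrable_measurable)
    have sq: "square_integrable (\<lambda>x. max 0 (g x))" "square_integrable (\<lambda>x. max 0 (- g x))"
      by (auto intro!: square_integrable_bound[OF g(1)])
    have "abs_L2 (\<lambda>x. max 0 (g x)) - abs_L2 (\<lambda>x. max 0 (- g x)) \<in> closure L2_dense"
      by (intro closure_L2_dense_diff closure_L2_dense_nonneg sq) auto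
    also have "abs_L2 (\<lambda>x. max 0 (g x)) - abs_L2 (\<lambda>x. max 0 (- g x)) = abs_L2 (\<lambda>x. max 0 (g x) - max 0 (- g x))"
      by (rule abs_L2_diff[OF sq, symmetric])
    also have "(\<lambda>x. max 0 (g x) - max 0 (- g x)) = g" by (auto simp: max_def)
    finally show ?thesis using g by simp
  qed
  then show ?thesis by auto
qed

instance L2 :: second_countable_topology
  by standard (rule ex_countable_subbasis_of_dense[OF countable_L2_dense closure_L2_dense])

instance vec :: ("{metric_space, second_countable_topology}", finite) second_countable_topology
proof
  obtain D :: "'a set" where D: "countable D" "\<And>X. open X \<Longrightarrow> X \<noteq> {} \<Longrightarrow> \<exists>d\<in>D. d \<in> X"
    by (rule countable_dense_setE) blast
  have "countable (vec_lambda ` (UNIV \<rightarrow>\<^sub>E D) :: ('a ^ 'b) set)"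
    using D(1) by (intro countable_image countable_PiE) auto
  moreover have "closure (vec_lambda ` (UNIV \<rightarrow>\<^sub>E D) :: ('a ^ 'b) set) = UNIV"
  proof -
    have "v \<in> closure (vec_lambda ` (UNIV \<rightarrow>\<^sub>E D))" for v :: "'a ^ 'b"
      unfolding closure_approachable
    proof (intro allI impI)
      fix e :: real assume "0 < e"
      define k where "k = e / (2 * real CARD('b))"
      have "0 < k" using \<open>0 < e\<close> by (simp add: k_def)
      then have "\<forall>i. \<exists>d\<in>D. d \<in> ball (v $ i) k" by (intro allI D(2)) auto
      then have "\<forall>i. \<exists>d. d \<in> D \<and> dist d (v $ i) < k" by (auto simp: dist_commute)
      then obtain d where d: "\<And>i. d i \<in> D" "\<And>i. dist (d i) (v $ i) < k"
        using choice[of "\<lambda>i d. d \<in> D \<and> dist d (v $ i) < k"] by auto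
      have "dist (vec_lambda d) v \<le> (\<Sum>i\<in>UNIV. dist (d i) (v $ i))"
        unfolding dist_vec_def using L2_set_le_sum[of UNIV "\<lambda>i. dist (d i) (v $ i)"] by simp
      also have "\<dots> \<le> (\<Sum>i\<in>(UNIV::'b set). k)"
        using d by (intro sum_mono less_imp_le) auto
      also have "\<dots> < e" using \<open>0 < e\<close> by (simp add: k_def)
      finally show "\<exists>y\<in>vec_lambda ` (UNIV \<rightarrow>\<^sub>E D). dist y v < e"
        using d(1) by (intro bexI[of _ "vec_lambda d"] imageI) (auto simp: PiE_def)
    qed
    then show ?thesis by auto
  qed
  ultimately show "\<exists>B::('a^'b) set set. countable B \<and> open = generate_topology B"
    by (rule ex_countable_subbasis_of_dense)
qed

lemma L2_eval_exists:
  "\<exists>e :: L2 \<Rightarrow> real \<Rightarrow> real. (\<lambda>(f, t). e f t) \<in> borel_measurable (borel \<Otimes>\<^sub>M borel) \<and>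
     (\<forall>f. square_integrable (e f) \<and> abs_L2 (e f) = f)"
proof -
  define d where "d = from_nat_into L2_dense"
  have "0 \<in> L2_dense" unfolding L2_dense_def by (rule image_eqI[of _ _ "[]"]) auto
  then have d: "range d = L2_dense"
    unfolding d_def by (intro range_from_nat_into countable_L2_dense) auto
  define m where "m k f = (LEAST n. dist (d n) f < (1/2)^k)" for k :: nat and f
  have m: "norm (d (m k f) - f) \<le> (1/2)^k" for k f
  proof -
    have "\<exists>n. dist (d n) f < (1/2)^k"
      using closure_approachable[of f L2_dense] closure_L2_dense d
      by (metis UNIV_I half_gt_zero_iff rangeE zero_less_one zero_less_power)
    then have "dist (d (m k f)) f < (1/2)^k" unfolding m_def by (rule LeastI_ex)
    then show ?thesis by (simp add: dist_norm)
  qed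
  have [measurable]: "m k \<in> borel \<rightarrow>\<^sub>M count_space UNIV" for k
    unfolding m_def by measurable
  have [measurable]: "rep_L2 (d n) \<in> borel_measurable borel" for n
    by (rule square_integrable_measurable[OF square_integrable_rep])
  define e where "e f t = lim (\<lambda>k. rep_L2 (d (m k f)) t)" for f t
  have meas: "(\<lambda>(f, t). e f t) \<in> borel_measurable (borel \<Otimes>\<^sub>M borel)"
    unfolding e_def split_beta'
  proof (rule borel_measurable_lim_metric)
    fix k
    show "(\<lambda>x. rep_L2 (d (m k (fst x))) (snd x)) \<in> borel_measurable (borel \<Otimes>\<^sub>M borel)"
      by (rule measurable_compose_countable[where f = "\<lambda>n x. rep_L2 (d n) (snd x)"]) measurable
  qed
  have "square_integrable (e f) \<and> abs_L2 (e f) = f" for f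
  proof -
    have "AE t in lborel. summable (\<lambda>k. \<bar>rep_L2 (d (m k f)) t - rep_L2 f t\<bar>)"
      by (rule AE_summable_L2) (simp_all add: square_integrable_rep m)
    then have ae: "AE t in lborel. rep_L2 f t = e f t"
    proof eventually_elim
      fix t assume "summable (\<lambda>k. \<bar>rep_L2 (d (m k f)) t - rep_L2 f t\<bar>)"
      then have "(\<lambda>k. rep_L2 (d (m k f)) t - rep_L2 f t) \<longlonglongrightarrow> 0"
        by (rule summable_LIMSEQ_zero[OF summable_rabs_cancel])
      then show "rep_L2 f t = e f t" by (simp add: e_def LIM_zero_iff limI)
    qed
    have [measurable]: "e f \<in> borel_measurable borel"
      using measurable_compose_Pair1[OF _ meas, of f] by simp
    have [measurable]: "rep_L2 f \<in> borel_measurable borel"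
      by (rule square_integrable_measurable[OF square_integrable_rep])
    have "integrable lborel (\<lambda>t. (rep_L2 f t)\<^sup>2)"
      using square_integrable_rep[of f] by (simp add: square_integrable_def)
    then have "integrable lborel (\<lambda>t. (e f t)\<^sup>2)"
      by (rule integrable_cong_AE_imp) (use ae in auto)
    then have "square_integrable (e f)" by (simp add: square_integrable_def)
    moreover from this have "abs_L2 (rep_L2 f) = abs_L2 (e f)"
      using ae by (subst abs_L2_eq_iff) (auto simp: square_integrable_rep)
    ultimately show ?thesis by simp
  qed
  with meas show ?thesis by blast
qed

text \<open>
  Point evaluation of square-integrable classes, through one jointly measurable choice of
  representatives. For a random element \<open>U\<close> the map \<open>(\<omega>, t) \<mapsto> L2_eval (U \<omega>) t\<close> is then a jointly
  measurable version of the process \<open>U\<^sub>t\<close>, so that pointwise expectations such as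
  \<open>E [(U\<^sub>t)\<^sup>2]\<close> make sense for almost every \<open>t\<close>.
\<close>

definition L2_eval :: "L2 \<Rightarrow> real \<Rightarrow> real" where
  "L2_eval = (SOME e. (\<lambda>(f, t). e f t) \<in> borel_measurable (borel \<Otimes>\<^sub>M borel) \<and>
     (\<forall>f. square_integrable (e f) \<and> abs_L2 (e f) = f))"

lemma measurable_L2_eval: "(\<lambda>(f, t). L2_eval f t) \<in> borel_measurable (borel \<Otimes>\<^sub>M borel)"
  and square_integrable_L2_eval: "square_integrable (L2_eval f)"
  and abs_L2_eval [simp]: "abs_L2 (L2_eval f) = f"
  using someI_ex[OF L2_eval_exists] unfolding L2_eval_def[symmetric] by auto

definition L2_vec_eval :: "L2 ^ 'n \<Rightarrow> real \<Rightarrow> real ^ 'n" where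
  "L2_vec_eval U t = (\<chi> i. L2_eval (U $ i) t)"

text \<open>
  \<open>L\<^sup>2([T\<^sub>1, T\<^sub>2])\<close> is identified with the closed subspace of \<open>L\<^sup>2(\<real>)\<close> of the classes vanishing off the
  interval (extension by zero). The type \<open>L2 ^ 'n\<close> carries the \<open>\<ell>\<^sup>2\<close> product inner product.
\<close>

definition L2_interval :: "real \<Rightarrow> real \<Rightarrow> L2 set" where
  "L2_interval T\<^sub>1 T\<^sub>2 = abs_L2 ` {f. square_integrable f \<and> (\<forall>t. t \<notin> {T\<^sub>1..T\<^sub>2} \<longrightarrow> f t = 0)}"

definition L2_power :: "real \<Rightarrow> real \<Rightarrow> (L2 ^ 'n) set" where
  "L2_power T\<^sub>1 T\<^sub>2 = {U. \<forall>i. U $ i \<in> L2_interval T\<^sub>1 T\<^sub>2}"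

definition L2_square :: "real \<Rightarrow> real \<Rightarrow> (real \<times> real \<Rightarrow> real) set" where
  "L2_square T\<^sub>1 T\<^sub>2 = {b. set_borel_measurable lborel ({T\<^sub>1..T\<^sub>2} \<times> {T\<^sub>1..T\<^sub>2}) b \<and>
     set_integrable lborel ({T\<^sub>1..T\<^sub>2} \<times> {T\<^sub>1..T\<^sub>2}) (\<lambda>x. (b x)\<^sup>2)}"

definition Polish_space :: "'a topology \<Rightarrow> bool" where
  "Polish_space X \<longleftrightarrow> completely_metrizable_space X \<and> second_countable X"

text \<open>
  A Lusin space is a Hausdorff space that is the image of a Polish space under a continuous
  bijection. Transporting the Polish topology along the bijection, one may take it to live on
  the same type as the given space.
\<close>

definition Lusin_space :: "'a topology \<Rightarrow> bool" where
  "Lusin_space X \<longleftrightarrow> Hausdorff_space X \<and>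
     (\<exists>(Y :: 'a topology) f. Polish_space Y \<and> continuous_map Y X f \<and>
        bij_betw f (topspace Y) (topspace X))"

definition bounded_linear_on ::
  "'a::real_normed_vector set \<Rightarrow> ('a \<Rightarrow> 'b::real_normed_vector) \<Rightarrow> bool" where
  "bounded_linear_on V F \<longleftrightarrow> subspace V \<and>
     (\<forall>x\<in>V. \<forall>y\<in>V. F (x + y) = F x + F y) \<and>
     (\<forall>c. \<forall>x\<in>V. F (c *\<^sub>R x) = c *\<^sub>R F x) \<and>
     (\<exists>K. \<forall>x\<in>V. norm (F x) \<le> K * norm x)"

definition range_I_minus :: "'a::real_vector set \<Rightarrow> ('a \<Rightarrow> 'a) \<Rightarrow> 'a set" where
  "range_I_minus D T = (\<lambda>x. x - T x) ` D"

text \<open>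
  \<open>S\<close> is the bounded linear extension to \<open>L2_power T\<^sub>1 T\<^sub>2\<close> of the inverse of
  \<open>I - T\<close>, where \<open>T\<close> is an operator with domain \<open>D\<close>.
\<close>

definition solution_operator ::
  "real \<Rightarrow> real \<Rightarrow> (L2 ^ 'n) set \<Rightarrow> (L2 ^ 'n \<Rightarrow> L2 ^ 'n) \<Rightarrow> (L2 ^ 'n \<Rightarrow> L2 ^ 'n) \<Rightarrow> bool" where
  "solution_operator T\<^sub>1 T\<^sub>2 D T S \<longleftrightarrow>
     D \<subseteq> L2_power T\<^sub>1 T\<^sub>2 \<and> T ` D \<subseteq> L2_power T\<^sub>1 T\<^sub>2 \<and>
     L2_power T\<^sub>1 T\<^sub>2 \<subseteq> closure (range_I_minus D T) \<and>
     Lusin_space (top_of_set (range_I_minus D T)) \<and>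
     inj_on (\<lambda>x. x - T x) D \<and>
     bounded_linear_on (range_I_minus D T) (inv_into D (\<lambda>x. x - T x)) \<and>
     bounded_linear_on (L2_power T\<^sub>1 T\<^sub>2) S \<and> S ` L2_power T\<^sub>1 T\<^sub>2 \<subseteq> L2_power T\<^sub>1 T\<^sub>2 \<and>
     (\<forall>y\<in>range_I_minus D T. S y = inv_into D (\<lambda>x. x - T x) y)"

definition shift_norm_sq :: "real \<Rightarrow> real \<Rightarrow> 'w measure \<Rightarrow> ('w \<Rightarrow> L2 ^ 'n) \<Rightarrow> ennreal" where
  "shift_norm_sq T\<^sub>1 T\<^sub>2 M U =
     (\<Sum>i\<in>UNIV. \<integral>\<^sup>+t\<in>{T\<^sub>1..T\<^sub>2}. (\<integral>\<^sup>+\<omega>. ennreal ((L2_eval (U \<omega> $ i) t)\<^sup>2) \<partial>M) \<partial>lborel)"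

definition shift_space :: "real \<Rightarrow> real \<Rightarrow> 'w measure \<Rightarrow> ('w \<Rightarrow> L2 ^ 'n) set" where
  "shift_space T\<^sub>1 T\<^sub>2 M = {U \<in> borel_measurable M.
     (\<forall>\<omega>\<in>space M. U \<omega> \<in> L2_power T\<^sub>1 T\<^sub>2) \<and> shift_norm_sq T\<^sub>1 T\<^sub>2 M U < \<infinity>}"

text \<open>
  Closure in the Hilbert space \<open>shift_space\<close>, intended to be applied to \<open>admissible_shifts\<close> below. That
  \<open>sqrt \<gamma> A\<close> lies in the closure of the ambient family \<open>\<A>\<close> only would not do: for \<open>A \<noteq> 0\<close> and
  \<open>\<A> = {c A | c > sqrt \<gamma>}\<close> it does, although no member of \<open>\<A>\<close> is admissible.
\<close>

definition shift_closure ::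
  "real \<Rightarrow> real \<Rightarrow> 'w measure \<Rightarrow> ('w \<Rightarrow> L2 ^ 'n) set \<Rightarrow> ('w \<Rightarrow> L2 ^ 'n) set" where
  "shift_closure T\<^sub>1 T\<^sub>2 M B = {U \<in> shift_space T\<^sub>1 T\<^sub>2 M.
     \<forall>r>0. \<exists>W\<in>B. sqrt (enn2real (shift_norm_sq T\<^sub>1 T\<^sub>2 M (\<lambda>\<omega>. W \<omega> - U \<omega>))) < r}"

definition shift_kernel :: "'w measure \<Rightarrow> ('w \<Rightarrow> L2 ^ 'n) \<Rightarrow> real \<Rightarrow> real \<Rightarrow> real ^ 'n ^ 'n" where
  "shift_kernel M A s t = (\<chi> i j. \<integral>\<omega>. L2_eval (A \<omega> $ i) s * L2_eval (A \<omega> $ j) t \<partial>M)"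

definition shift_form ::
  "real \<Rightarrow> real \<Rightarrow> 'w measure \<Rightarrow> ('w \<Rightarrow> L2 ^ 'n) \<Rightarrow> L2 ^ 'n \<Rightarrow> real" where
  "shift_form T\<^sub>1 T\<^sub>2 M A g =
     set_lebesgue_integral lborel ({T\<^sub>1..T\<^sub>2} \<times> {T\<^sub>1..T\<^sub>2})
       (\<lambda>(s, t). (L2_vec_eval g s v* shift_kernel M A s t) \<bullet> L2_vec_eval g t)"

definition admissible_shifts ::
  "real \<Rightarrow> real \<Rightarrow> 'w measure \<Rightarrow> real \<Rightarrow> ('w \<Rightarrow> L2 ^ 'n) set \<Rightarrow> ('w \<Rightarrow> L2 ^ 'n) \<Rightarrow> ('w \<Rightarrow> L2 ^ 'n) set"
  where
  "admissible_shifts T\<^sub>1 T\<^sub>2 M \<gamma> \<A> A = {A' \<in> \<A>.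
     \<forall>g\<in>L2_power T\<^sub>1 T\<^sub>2. shift_form T\<^sub>1 T\<^sub>2 M A' g \<le> \<gamma> * shift_form T\<^sub>1 T\<^sub>2 M A g}"

text \<open>
  \<open>N\<close>, with projection \<open>\<pi>\<close>, extends the probability space \<open>M\<close>; \<open>e\<close> is a copy of the
  noise \<open>\<epsilon>\<close> on \<open>N\<close>, independent of the shift \<open>A\<close> lifted to \<open>N\<close>.
\<close>

definition noise_extension ::
  "real \<Rightarrow> real \<Rightarrow> 'w measure \<Rightarrow> ('w \<Rightarrow> L2 ^ 'n) \<Rightarrow> ('w \<Rightarrow> L2 ^ 'n) \<Rightarrow>
     'e measure \<Rightarrow> ('e \<Rightarrow> 'w) \<Rightarrow> ('e \<Rightarrow> L2 ^ 'n) \<Rightarrow> bool" where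
  "noise_extension T\<^sub>1 T\<^sub>2 M \<epsilon> A N \<pi> e \<longleftrightarrow>
     prob_space N \<and> \<pi> \<in> N \<rightarrow>\<^sub>M M \<and> distr N M \<pi> = M \<and>
     e \<in> borel_measurable N \<and> (\<forall>x\<in>space N. e x \<in> L2_power T\<^sub>1 T\<^sub>2) \<and>
     distr N borel e = distr M borel \<epsilon> \<and>
     prob_space.indep_var N borel e borel (\<lambda>x. A (\<pi> x))"

text \<open>
  The risk in the environment \<open>S (A + e)\<close>. The component with index \<open>None\<close> is the response and
  those with index \<open>Some i\<close> are the covariates, so \<open>'p option\<close> has \<open>p + 1\<close> elements.
\<close>

definition risk ::
  "real \<Rightarrow> real \<Rightarrow> (L2 ^ ('p option) \<Rightarrow> L2 ^ ('p option)) \<Rightarrow> 'e measure \<Rightarrow>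
     ('e \<Rightarrow> L2 ^ ('p option)) \<Rightarrow> ('e \<Rightarrow> L2 ^ ('p option)) \<Rightarrow> ('p::finite \<Rightarrow> real \<times> real \<Rightarrow> real) \<Rightarrow> real"
  where
  "risk T\<^sub>1 T\<^sub>2 S N A e \<beta> =
     (\<integral>x. (LINT t:{T\<^sub>1..T\<^sub>2}|lborel.
        (L2_eval (S (A x + e x) $ None) t -
         (LINT \<tau>:{T\<^sub>1..T\<^sub>2}|lborel. \<Sum>i\<in>UNIV. \<beta> i (t, \<tau>) * L2_eval (S (A x + e x) $ Some i) \<tau>))\<^sup>2) \<partial>N)"

end

theory Submission
  imports Defs
begin

text \<open>
  Let \<open>L\<close> send a shift to the prediction error of the environment it produces: apply the solution
  operator, then subtract from the response its regression on the covariates with kernels \<open>\<beta>\<close>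
  (\<open>prediction_error_op\<close>). Integral operators with square-integrable kernels are bounded, so \<open>L\<close> is a
  bounded linear map. As the noise is centred and independent of the shift, the mixed term in
  \<open>E \<parallel>L (B + \<epsilon>)\<parallel>\<^sup>2\<close> vanishes and the risk of the environment with shift \<open>B\<close> is
  \<open>E \<parallel>L B\<parallel>\<^sup>2 + E \<parallel>L \<epsilon>\<parallel>\<^sup>2\<close> (\<open>risk_eq\<close>). The observational risk is the second summand, the risk difference
  is \<open>E \<parallel>L A\<parallel>\<^sup>2\<close>, and the claim becomes that \<open>E \<parallel>L A'\<parallel>\<^sup>2\<close> has supremum \<open>\<gamma> E \<parallel>L A\<parallel>\<^sup>2\<close> over the admissible \<open>A'\<close>.

  No admissible \<open>A'\<close> exceeds this value. By Fubini's theorem the quadratic form of the covariance kernel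
  at \<open>g\<close> is \<open>E \<langle>A, g\<rangle>\<^sup>2\<close> (\<open>shift_form_eq\<close>), so admissibility says that \<open>E \<langle>A', g\<rangle>\<^sup>2 \<le> \<gamma> E \<langle>A, g\<rangle>\<^sup>2\<close> for
  all \<open>g\<close>. Such a comparison passes to every bounded linear image (\<open>dominated_second_moments\<close>):
  with the adjoint one would write \<open>E \<parallel>L A\<parallel>\<^sup>2\<close> as the sum of \<open>E \<langle>A, L\<^sup>* e\<^sub>n\<rangle>\<^sup>2\<close> over an orthonormal basis and
  compare term by term. Here adjoint and basis are both replaced by finite-rank orthogonal
  projections that converge pointwise to the identity (\<open>orth_proj_tendsto_identity\<close>): after a
  projection in the domain a functional is an inner product with some \<open>g\<close>, and after one in the codomain
  the squared norm is a finite sum of squared functionals.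

  The value is approached because \<open>sqrt \<gamma> A\<close> is a limit of admissible shifts and the second moment
  of \<open>L\<close> is continuous on the shift space (\<open>shift_closure_second_moment\<close>).
\<close>

section \<open>Approximation of the identity by finite-rank orthogonal projections\<close>

definition finite_orthonormal :: "'a::real_inner set \<Rightarrow> bool" where
  "finite_orthonormal C \<longleftrightarrow> finite C \<and> (\<forall>c\<in>C. \<forall>d\<in>C. c \<bullet> d = (if c = d then 1 else 0))"

definition orth_proj :: "'a::real_inner set \<Rightarrow> 'a \<Rightarrow> 'a" where
  "orth_proj C x = (\<Sum>c\<in>C. (x \<bullet> c) *\<^sub>R c)"

lemma inner_orth_proj:
  assumes "finite_orthonormal C" "d \<in> C"
  shows "orth_proj C x \<bullet> d = x \<bullet> d"
proof -
  have "orth_proj C x \<bullet> d = (\<Sum>c\<in>C. (x \<bullet> c) * (c \<bullet> d))"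
    by (simp add: orth_proj_def inner_sum_left)
  also have "\<dots> = (\<Sum>c\<in>C. if c = d then x \<bullet> c else 0)"
    using assms by (intro sum.cong) (auto simp: finite_orthonormal_def)
  finally have "orth_proj C x \<bullet> d = (\<Sum>c\<in>C. if c = d then x \<bullet> c else 0)" .
  then show ?thesis
    using assms by (simp add: finite_orthonormal_def)
qed

lemma orth_proj_orthogonal_span:
  assumes "finite_orthonormal C" "y \<in> span C"
  shows "(x - orth_proj C x) \<bullet> y = 0"
  using assms(2)
proof (induction rule: span_induct_alt)
  case (step c z w)
  then show ?case
    using inner_orth_proj[OF assms(1), of z x] by (simp add: inner_add_right inner_diff_left)
qed simp

lemma orth_proj_in_span: "orth_proj C x \<in> span C"
  unfolding orth_proj_def by (intro span_sum span_scale span_base)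

lemma norm_minus_orth_proj_le:
  assumes "finite_orthonormal C" "y \<in> span C"
  shows "norm (x - orth_proj C x) \<le> norm (x - y)"
proof -
  have "orth_proj C x - y \<in> span C"
    using assms(2) by (intro span_diff orth_proj_in_span)
  then have "orthogonal (x - orth_proj C x) (orth_proj C x - y)"
    using orth_proj_orthogonal_span[OF assms(1)] by (simp add: orthogonal_def)
  from norm_add_Pythagorean[OF this]
  have "(norm (x - orth_proj C x))\<^sup>2 \<le> (norm (x - y))\<^sup>2" by simp
  then show ?thesis by (rule power2_le_imp_le) simp
qed

lemma norm_orth_proj_le:
  assumes "finite_orthonormal C"
  shows "norm (orth_proj C x) \<le> norm x"
proof -
  have "orthogonal (x - orth_proj C x) (orth_proj C x)"
    using orth_proj_orthogonal_span[OF assms orth_proj_in_span] by (simp add: orthogonal_def)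
  from norm_add_Pythagorean[OF this]
  have "(norm (orth_proj C x))\<^sup>2 \<le> (norm x)\<^sup>2" by simp
  then show ?thesis by (rule power2_le_imp_le) simp
qed

lemma norm_orth_proj_sq:
  assumes "finite_orthonormal C"
  shows "(norm (orth_proj C x))\<^sup>2 = (\<Sum>c\<in>C. (x \<bullet> c)\<^sup>2)"
proof -
  have "(norm (orth_proj C x))\<^sup>2 = (\<Sum>c\<in>C. (x \<bullet> c) * (orth_proj C x \<bullet> c))"
    unfolding power2_norm_eq_inner
    by (subst (2) orth_proj_def) (simp add: inner_sum_right)
  also have "\<dots> = (\<Sum>c\<in>C. (x \<bullet> c)\<^sup>2)"
    using inner_orth_proj[OF assms] by (intro sum.cong) (auto simp: power2_eq_square)
  finally show ?thesis .
qed

lemma finite_orthonormal_basis_of_span: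
  fixes B :: "'a::real_inner set"
  assumes "finite B"
  shows "\<exists>C. finite_orthonormal C \<and> span C = span B"
proof -
  obtain C where C: "finite C" "span C = span B" "pairwise orthogonal C"
    using basis_orthogonal[OF assms] by blast
  let ?C = "(\<lambda>c. c /\<^sub>R norm c) ` (C - {0})"
  have "finite_orthonormal ?C"
    unfolding finite_orthonormal_def
  proof (intro conjI ballI)
    fix u v assume "u \<in> ?C" "v \<in> ?C"
    then obtain c d where *: "c \<in> C" "c \<noteq> 0" "u = c /\<^sub>R norm c" "d \<in> C" "d \<noteq> 0" "v = d /\<^sub>R norm d"
      by auto
    show "u \<bullet> v = (if u = v then 1 else 0)"
    proof (cases "u = v")
      case True
      then show ?thesis
        using * by (simp add: power2_norm_eq_inner[symmetric] power2_eq_square)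
    next
      case False
      then have "c \<noteq> d" using * by auto
      then have "c \<bullet> d = 0" using C(3) * by (auto simp: pairwise_def orthogonal_def)
      with False show ?thesis using * by simp
    qed
  qed (use C(1) in simp)
  moreover have "span ?C = span C"
  proof -
    have "span ?C = span (C - {0})"
      using C(1) by (intro span_image_scale) auto
    then show ?thesis by (simp add: span_delete_0)
  qed
  ultimately show ?thesis using C(2) by blast
qed

text \<open>
  Orthonormalising the first \<open>n\<close> members of a dense sequence makes the projections converge, since
  the projection is the best approximation from the span.
\<close>

lemma orth_proj_tendsto_identity:
  "\<exists>C :: nat \<Rightarrow> 'a::{real_inner, second_countable_topology} set.
     (\<forall>n. finite_orthonormal (C n)) \<and> (\<forall>x. (\<lambda>n. orth_proj (C n) x) \<longlonglongrightarrow> x)"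
proof -
  obtain D :: "'a set" where D: "countable D" "\<And>X. open X \<Longrightarrow> X \<noteq> {} \<Longrightarrow> \<exists>d\<in>D. d \<in> X"
    by (rule countable_dense_setE) blast
  have "D \<noteq> {}" using D(2)[of UNIV] by auto
  define d where "d = from_nat_into D"
  have d: "range d = D"
    unfolding d_def by (rule range_from_nat_into[OF \<open>D \<noteq> {}\<close> D(1)])
  have "\<forall>n. \<exists>C. finite_orthonormal C \<and> span C = span (d ` {..n})"
    by (intro allI finite_orthonormal_basis_of_span) simp
  then obtain C where C: "\<And>n. finite_orthonormal (C n)" "\<And>n. span (C n) = span (d ` {..n})"
    by metis
  have "(\<lambda>n. orth_proj (C n) x) \<longlonglongrightarrow> x" for x
  proof (rule metric_LIMSEQ_I)
    fix r :: real assume "0 < r"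
    then obtain k where k: "dist x (d k) < r"
      using D(2)[of "ball x r"] d by auto
    have "dist (orth_proj (C n) x) x < r" if "k \<le> n" for n
    proof -
      have "d k \<in> span (C n)" unfolding C(2) using that by (intro span_base) auto
      from norm_minus_orth_proj_le[OF C(1) this, of x] k show ?thesis
        by (simp add: dist_norm norm_minus_commute)
    qed
    then show "\<exists>no. \<forall>n\<ge>no. dist (orth_proj (C n) x) x < r" by blast
  qed
  with C(1) show ?thesis by blast
qed

section \<open>Domination of second moments\<close>

definition finite_second_moment :: "'w measure \<Rightarrow> ('w \<Rightarrow> 'a::real_normed_vector) \<Rightarrow> bool" where
  "finite_second_moment M X \<longleftrightarrow> X \<in> borel_measurable M \<and> integrable M (\<lambda>w. (norm (X w))\<^sup>2)"

lemma borel_measurable_bounded_linear: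
  fixes L :: "'a::real_normed_vector \<Rightarrow> 'b::real_normed_vector"
  assumes "bounded_linear L"
  shows "L \<in> borel_measurable borel"
  using linear_continuous_on[OF assms] by (rule borel_measurable_continuous_onI)

lemma finite_second_moment_bounded_linear:
  assumes "bounded_linear L" "finite_second_moment M X"
  shows "finite_second_moment M (\<lambda>w. L (X w))"
proof -
  obtain K where K: "\<And>x. norm (L x) \<le> norm x * K"
    using bounded_linear.nonneg_bounded[OF assms(1)] by blast
  have [measurable]: "X \<in> borel_measurable M" "L \<in> borel_measurable borel"
    using assms by (auto simp: finite_second_moment_def borel_measurable_bounded_linear)
  have "(norm (L x))\<^sup>2 \<le> K\<^sup>2 * (norm x)\<^sup>2" for x
    using power_mono[OF K[of x] norm_ge_zero, of 2] by (simp add: power_mult_distrib mult.commute)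
  moreover have "integrable M (\<lambda>w. K\<^sup>2 * (norm (X w))\<^sup>2)"
    using assms(2) by (simp add: finite_second_moment_def)
  ultimately have "integrable M (\<lambda>w. (norm (L (X w)))\<^sup>2)"
    by (intro Bochner_Integration.integrable_bound[OF \<open>integrable M (\<lambda>w. K\<^sup>2 * (norm (X w))\<^sup>2)\<close>]) auto
  then show ?thesis by (simp add: finite_second_moment_def)
qed

lemma tendsto_second_moment_orth_proj:
  fixes X :: "'w \<Rightarrow> 'a::real_inner" and L :: "'a \<Rightarrow> 'b::real_normed_vector"
  assumes "bounded_linear L" "finite_second_moment M X"
    and "\<And>n. finite_orthonormal (C n)" "\<And>x. (\<lambda>n. orth_proj (C n) x) \<longlonglongrightarrow> x"
  shows "(\<lambda>n. \<integral>w. (norm (L (orth_proj (C n) (X w))))\<^sup>2 \<partial>M) \<longlonglongrightarrow> (\<integral>w. (norm (L (X w)))\<^sup>2 \<partial>M)"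
proof -
  obtain K where K: "0 \<le> K" "\<And>x. norm (L x) \<le> norm x * K"
    using bounded_linear.nonneg_bounded[OF assms(1)] by blast
  have blp: "bounded_linear (orth_proj (C n))" for n
    unfolding orth_proj_def[abs_def] by (intro bounded_linear_intros)
  have [measurable]: "X \<in> borel_measurable M" "L \<in> borel_measurable borel"
      "\<And>n. orth_proj (C n) \<in> borel_measurable borel"
    using assms blp by (auto simp: finite_second_moment_def borel_measurable_bounded_linear)
  show ?thesis
  proof (rule integral_dominated_convergence[where w = "\<lambda>w. K\<^sup>2 * (norm (X w))\<^sup>2"])
    show "integrable M (\<lambda>w. K\<^sup>2 * (norm (X w))\<^sup>2)"
      using assms(2) by (simp add: finite_second_moment_def)
    show "AE w in M. (\<lambda>n. (norm (L (orth_proj (C n) (X w))))\<^sup>2) \<longlonglongrightarrow> (norm (L (X w)))\<^sup>2"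
      by (intro AE_I2 tendsto_intros bounded_linear.tendsto[OF assms(1)] assms(4))
    show "AE w in M. norm ((norm (L (orth_proj (C n) (X w))))\<^sup>2) \<le> K\<^sup>2 * (norm (X w))\<^sup>2" for n
    proof (rule AE_I2)
      fix w
      have "norm (L (orth_proj (C n) (X w))) \<le> norm (orth_proj (C n) (X w)) * K" by (rule K(2))
      also have "\<dots> \<le> norm (X w) * K"
        by (intro mult_right_mono norm_orth_proj_le assms(3) K(1))
      finally have "(norm (L (orth_proj (C n) (X w))))\<^sup>2 \<le> (norm (X w) * K)\<^sup>2"
        by (intro power_mono) auto
      then show "norm ((norm (L (orth_proj (C n) (X w))))\<^sup>2) \<le> K\<^sup>2 * (norm (X w))\<^sup>2"
        by (simp add: power_mult_distrib mult.commute)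
    qed
  qed measurable
qed

text \<open>
  A functional composed with a finite-rank projection is the inner product with an explicit vector,
  so hypotheses about inner products apply to it.
\<close>

lemma functional_orth_proj:
  assumes "linear \<phi>"
  shows "(\<phi> (orth_proj C x) :: real) = x \<bullet> (\<Sum>c\<in>C. \<phi> c *\<^sub>R c)"
  using assms
  by (simp add: orth_proj_def linear_sum linear_scale inner_sum_right mult.commute)

text \<open>
  The hypothesis gives the claim for \<open>\<phi> = (\<lambda>x. x \<bullet> g)\<close>, hence for \<open>\<phi>\<close> composed with a finite-rank
  projection, and dominated convergence removes the projection.
\<close>

lemma dominated_second_moments_functional:
  fixes X Y :: "'w \<Rightarrow> 'a::{real_inner, second_countable_topology}"
  assumes X: "finite_second_moment M X" and Y: "finite_second_moment M Y"
    and dom: "\<And>g. (\<integral>w. (X w \<bullet> g)\<^sup>2 \<partial>M) \<le> \<gamma> * (\<integral>w. (Y w \<bullet> g)\<^sup>2 \<partial>M)"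
    and \<phi>: "bounded_linear \<phi>"
  shows "(\<integral>w. (\<phi> (X w))\<^sup>2 \<partial>M) \<le> \<gamma> * (\<integral>w. ((\<phi> (Y w) :: real))\<^sup>2 \<partial>M)"
proof -
  obtain C :: "nat \<Rightarrow> 'a set" where C: "\<And>n. finite_orthonormal (C n)" "\<And>x. (\<lambda>n. orth_proj (C n) x) \<longlonglongrightarrow> x"
    using orth_proj_tendsto_identity by blast
  have lin: "linear \<phi>" using \<phi> by (rule bounded_linear.linear)
  show ?thesis
  proof (rule LIMSEQ_le)
    show "(\<lambda>n. \<integral>w. (\<phi> (orth_proj (C n) (X w)))\<^sup>2 \<partial>M) \<longlonglongrightarrow> (\<integral>w. (\<phi> (X w))\<^sup>2 \<partial>M)"
      using tendsto_second_moment_orth_proj[OF \<phi> X C] by simp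
    show "(\<lambda>n. \<gamma> * (\<integral>w. (\<phi> (orth_proj (C n) (Y w)))\<^sup>2 \<partial>M)) \<longlonglongrightarrow> \<gamma> * (\<integral>w. (\<phi> (Y w))\<^sup>2 \<partial>M)"
      using tendsto_second_moment_orth_proj[OF \<phi> Y C] by (intro tendsto_mult_left) simp
    show "\<exists>N. \<forall>n\<ge>N. (\<integral>w. (\<phi> (orth_proj (C n) (X w)))\<^sup>2 \<partial>M)
        \<le> \<gamma> * (\<integral>w. (\<phi> (orth_proj (C n) (Y w)))\<^sup>2 \<partial>M)"
      unfolding functional_orth_proj[OF lin] using dom by blast
  qed
qed

text \<open>
  The hypothesis bounds the covariance operator of \<open>X\<close> by \<open>\<gamma>\<close> times that of \<open>Y\<close>. Projecting in the codomain turns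
  the squared norm into a finite sum of squared functionals, to each of which the scalar comparison
  applies; the number of functionals does not enter the bound, so it survives the limit.
\<close>

lemma dominated_second_moments:
  fixes X Y :: "'w \<Rightarrow> 'a::{real_inner, second_countable_topology}"
    and L :: "'a \<Rightarrow> 'b::{real_inner, second_countable_topology}"
  assumes X: "finite_second_moment M X" and Y: "finite_second_moment M Y"
    and dom: "\<And>g. (\<integral>w. (X w \<bullet> g)\<^sup>2 \<partial>M) \<le> \<gamma> * (\<integral>w. (Y w \<bullet> g)\<^sup>2 \<partial>M)"
    and L: "bounded_linear L"
  shows "(\<integral>w. (norm (L (X w)))\<^sup>2 \<partial>M) \<le> \<gamma> * (\<integral>w. (norm (L (Y w)))\<^sup>2 \<partial>M)"
proof -
  obtain C :: "nat \<Rightarrow> 'b set" where C: "\<And>n. finite_orthonormal (C n)" "\<And>x. (\<lambda>n. orth_proj (C n) x) \<longlonglongrightarrow> x"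
    using orth_proj_tendsto_identity by blast
  note lim = tendsto_second_moment_orth_proj[OF bounded_linear_ident finite_second_moment_bounded_linear[OF L] C]
  have int: "integrable M (\<lambda>w. (L (Z w) \<bullet> c)\<^sup>2)" if "finite_second_moment M Z" for Z c
  proof -
    have "bounded_linear (\<lambda>x. L x \<bullet> c)"
      by (intro bounded_linear_inner_left_comp L)
    from finite_second_moment_bounded_linear[OF this that] show ?thesis
      by (simp add: finite_second_moment_def)
  qed
  show ?thesis
  proof (rule LIMSEQ_le[OF lim[OF X] tendsto_mult_left[OF lim[OF Y]]], intro exI allI impI)
    fix n
    have "(\<integral>w. (norm (orth_proj (C n) (L (X w))))\<^sup>2 \<partial>M) = (\<Sum>c\<in>C n. \<integral>w. (L (X w) \<bullet> c)\<^sup>2 \<partial>M)"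
      unfolding norm_orth_proj_sq[OF C(1)] by (intro Bochner_Integration.integral_sum int X)
    also have "\<dots> \<le> (\<Sum>c\<in>C n. \<gamma> * (\<integral>w. (L (Y w) \<bullet> c)\<^sup>2 \<partial>M))"
      by (intro sum_mono dominated_second_moments_functional[OF X Y dom] bounded_linear_inner_left_comp L)
    also have "\<dots> = \<gamma> * (\<integral>w. (norm (orth_proj (C n) (L (Y w))))\<^sup>2 \<partial>M)"
      unfolding norm_orth_proj_sq[OF C(1)] sum_distrib_left[symmetric]
      by (subst Bochner_Integration.integral_sum) (auto intro: int Y)
    finally show "(\<integral>w. (norm (orth_proj (C n) (L (X w))))\<^sup>2 \<partial>M)
        \<le> \<gamma> * (\<integral>w. (norm (orth_proj (C n) (L (Y w))))\<^sup>2 \<partial>M)" .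
  qed
qed

section \<open>Operators on square-integrable classes\<close>

lemma measurable_L2_eval_comp [measurable]:
  assumes "f \<in> M \<rightarrow>\<^sub>M borel" "g \<in> M \<rightarrow>\<^sub>M borel"
  shows "(\<lambda>x. L2_eval (f x) (g x)) \<in> borel_measurable M"
proof -
  have "(\<lambda>x. (f x, g x)) \<in> M \<rightarrow>\<^sub>M borel \<Otimes>\<^sub>M borel"
    using assms by measurable
  from measurable_compose[OF this measurable_L2_eval] show ?thesis by simp
qed

lemma AE_L2_eval_abs:
  assumes "square_integrable f"
  shows "AE t in lborel. L2_eval (abs_L2 f) t = f t"
  using abs_L2_eq_iff[OF square_integrable_L2_eval assms, of "abs_L2 f"] by simp

lemma AE_L2_eval_add: "AE t in lborel. L2_eval (f + g) t = L2_eval f t + L2_eval g t"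
  using AE_L2_eval_abs[OF square_integrable_add[OF square_integrable_L2_eval square_integrable_L2_eval], of f g]
  by (simp add: abs_L2_add square_integrable_L2_eval)

lemma AE_L2_eval_diff: "AE t in lborel. L2_eval (f - g) t = L2_eval f t - L2_eval g t"
  using AE_L2_eval_abs[OF square_integrable_diff[OF square_integrable_L2_eval square_integrable_L2_eval], of f g]
  by (simp add: abs_L2_diff square_integrable_L2_eval)

lemma AE_L2_eval_scale: "AE t in lborel. L2_eval (c *\<^sub>R f) t = c * L2_eval f t"
  using AE_L2_eval_abs[OF square_integrable_scale[OF square_integrable_L2_eval], of c f]
  by (simp add: abs_L2_scale square_integrable_L2_eval)

lemma AE_L2_eval_sum:
  assumes "finite J"
  shows "AE t in lborel. L2_eval (\<Sum>j\<in>J. f j) t = (\<Sum>j\<in>J. L2_eval (f j) t)"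
  using assms
proof (induction J)
  case empty
  show ?case using AE_L2_eval_abs[OF square_integrable_zero] by (simp add: abs_L2_zero)
next
  case (insert j J)
  from AE_L2_eval_add[of "f j" "\<Sum>j\<in>J. f j"] insert(3) show ?case
    by eventually_elim (use insert(1,2) in simp)
qed

lemma norm_abs_L2_sq: "square_integrable f \<Longrightarrow> (norm (abs_L2 f))\<^sup>2 = (\<integral>t. (f t)\<^sup>2 \<partial>lborel)"
  unfolding power2_norm_eq_inner by (simp add: inner_abs_L2 power2_eq_square)

lemma norm_L2_eval_sq: "(norm f)\<^sup>2 = (\<integral>t. (L2_eval f t)\<^sup>2 \<partial>lborel)"
  using norm_abs_L2_sq[OF square_integrable_L2_eval, of f] by simp

lemma abs_L2_cong_AE:
  assumes "square_integrable f" "g \<in> borel_measurable borel" "AE t in lborel. f t = g t"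
  shows "square_integrable g" "abs_L2 f = abs_L2 g"
proof -
  have [measurable]: "f \<in> borel_measurable borel" "g \<in> borel_measurable borel"
    using assms by (auto dest: square_integrable_measurable)
  have "integrable lborel (\<lambda>t. (f t)\<^sup>2)" using assms(1) by (simp add: square_integrable_def)
  then have "integrable lborel (\<lambda>t. (g t)\<^sup>2)"
    by (rule integrable_cong_AE_imp) (use assms(3) in auto)
  then show "square_integrable g" by (simp add: square_integrable_def)
  with assms show "abs_L2 f = abs_L2 g" by (simp add: abs_L2_eq_iff)
qed

text \<open>The Cauchy--Schwarz inequality in \<open>L2\<close>, applied to the classes of the absolute values.\<close>

lemma integral_abs_mult_le:
  assumes "square_integrable f" "square_integrable g"
  shows "(\<integral>t. \<bar>f t * g t\<bar> \<partial>lborel) \<le> norm (abs_L2 f) * norm (abs_L2 g)"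
proof -
  have sq: "square_integrable (\<lambda>t. \<bar>h t\<bar>)" if "square_integrable h" for h
    using that by (auto simp: square_integrable_def)
  have nrm: "norm (abs_L2 (\<lambda>t. \<bar>h t\<bar>)) = norm (abs_L2 h)" if "square_integrable h" for h
  proof (rule power2_eq_imp_eq)
    show "(norm (abs_L2 (\<lambda>t. \<bar>h t\<bar>)))\<^sup>2 = (norm (abs_L2 h))\<^sup>2"
      by (simp add: norm_abs_L2_sq sq that)
  qed auto
  have "(\<integral>t. \<bar>f t * g t\<bar> \<partial>lborel) = abs_L2 (\<lambda>t. \<bar>f t\<bar>) \<bullet> abs_L2 (\<lambda>t. \<bar>g t\<bar>)"
    by (simp add: inner_abs_L2 sq assms abs_mult)
  also have "\<dots> \<le> norm (abs_L2 (\<lambda>t. \<bar>f t\<bar>)) * norm (abs_L2 (\<lambda>t. \<bar>g t\<bar>))"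
    by (rule norm_cauchy_schwarz)
  finally show ?thesis by (simp add: nrm assms)
qed

lemma abs_integral_mult_le:
  assumes "square_integrable f" "square_integrable g"
  shows "\<bar>\<integral>t. f t * g t \<partial>lborel\<bar> \<le> norm (abs_L2 f) * norm (abs_L2 g)"
  using integral_abs_bound[of lborel "\<lambda>t. f t * g t"] integral_abs_mult_le[OF assms] by linarith

definition L2_restrict :: "real set \<Rightarrow> L2 \<Rightarrow> L2" where
  "L2_restrict I f = abs_L2 (\<lambda>t. indicator I t * L2_eval f t)"

context
  fixes I :: "real set"
  assumes I [measurable]: "I \<in> sets borel"
begin

lemma square_integrable_restrict: "square_integrable (\<lambda>t. indicator I t * L2_eval f t)"
  by (rule square_integrable_bound[OF square_integrable_L2_eval[of f]])
    (use square_integrable_measurable[OF square_integrable_L2_eval[of f]] in \<open>auto simp: indicator_def\<close>)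

lemma AE_L2_eval_restrict: "AE t in lborel. L2_eval (L2_restrict I f) t = indicator I t * L2_eval f t"
  unfolding L2_restrict_def by (rule AE_L2_eval_abs[OF square_integrable_restrict])

lemma norm_L2_restrict_le: "norm (L2_restrict I f) \<le> norm f"
proof (rule power2_le_imp_le)
  show "(norm (L2_restrict I f))\<^sup>2 \<le> (norm f)\<^sup>2"
    unfolding norm_L2_eval_sq[of f] L2_restrict_def norm_abs_L2_sq[OF square_integrable_restrict]
    using square_integrable_restrict[of f] square_integrable_L2_eval[of f]
    by (intro integral_mono) (auto simp: square_integrable_def indicator_def)
qed simp

lemma bounded_linear_L2_restrict: "bounded_linear (L2_restrict I)"
proof (rule bounded_linear_intro[where K = 1])
  fix f g :: L2 and c :: real
  have [measurable]: "L2_eval h \<in> borel_measurable borel" for h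
    by (rule square_integrable_measurable[OF square_integrable_L2_eval])
  show "L2_restrict I (f + g) = L2_restrict I f + L2_restrict I g"
    unfolding L2_restrict_def abs_L2_add[OF square_integrable_restrict square_integrable_restrict, symmetric]
  proof (rule abs_L2_cong_AE[OF square_integrable_restrict])
    show "AE t in lborel. indicator I t * L2_eval (f + g) t =
        indicator I t * L2_eval f t + indicator I t * L2_eval g t"
      using AE_L2_eval_add[of f g] by eventually_elim (simp add: distrib_left)
  qed measurable
  show "L2_restrict I (c *\<^sub>R f) = c *\<^sub>R L2_restrict I f"
    unfolding L2_restrict_def abs_L2_scale[OF square_integrable_restrict, symmetric]
  proof (rule abs_L2_cong_AE[OF square_integrable_restrict])
    show "AE t in lborel. indicator I t * L2_eval (c *\<^sub>R f) t = c * (indicator I t * L2_eval f t)"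
      using AE_L2_eval_scale[of c f] by eventually_elim simp
  qed measurable
  show "norm (L2_restrict I f) \<le> norm f * 1" by (simp add: norm_L2_restrict_le)
qed

lemma inner_L2_restrict: "L2_restrict I f \<bullet> g = (\<integral>t. indicator I t * L2_eval f t * L2_eval g t \<partial>lborel)"
  using inner_abs_L2[OF square_integrable_restrict square_integrable_L2_eval, of f g]
  by (simp add: L2_restrict_def)

lemma inner_L2_restrict_commute: "L2_restrict I f \<bullet> g = f \<bullet> L2_restrict I g"
  unfolding inner_L2_restrict inner_commute[of f "L2_restrict I g"] by (simp add: mult_ac)

end

lemma L2_restrict_in_interval: "L2_restrict {a..b} f \<in> L2_interval a b"
  unfolding L2_restrict_def L2_interval_def
  by (intro imageI) (auto intro: square_integrable_restrict)

lemma L2_restrict_eq_self: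
  assumes "f \<in> L2_interval a b"
  shows "L2_restrict {a..b} f = f"
proof -
  obtain h where h: "square_integrable h" "\<And>t. t \<notin> {a..b} \<Longrightarrow> h t = 0" "f = abs_L2 h"
    using assms by (auto simp: L2_interval_def)
  have "L2_restrict {a..b} f = abs_L2 h"
    unfolding L2_restrict_def
  proof (rule abs_L2_cong_AE)
    show "AE t in lborel. indicator {a..b} t * L2_eval f t = h t"
      using AE_L2_eval_abs[OF h(1)] by eventually_elim (use h(2,3) in \<open>auto simp: indicator_def\<close>)
  qed (use h in \<open>auto intro: square_integrable_restrict square_integrable_measurable\<close>)
  with h show ?thesis by simp
qed

text \<open>
  The restriction is the orthogonal projection onto the copy of \<open>L\<^sup>2([a, b])\<close> inside \<open>L\<^sup>2(\<real>)\<close>. Composing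
  with it turns an operator that is bounded and linear on that subspace only into one that is so on
  the whole space.
\<close>

definition L2_vec_restrict :: "real set \<Rightarrow> L2 ^ 'n \<Rightarrow> L2 ^ 'n" where
  "L2_vec_restrict I U = (\<chi> i. L2_restrict I (U $ i))"

lemma bounded_linear_L2_vec_restrict:
  assumes "I \<in> sets borel"
  shows "bounded_linear (L2_vec_restrict I :: L2 ^ 'n \<Rightarrow> _)"
proof (rule bounded_linear_intro[where K = 1])
  interpret bounded_linear "L2_restrict I" by (rule bounded_linear_L2_restrict[OF assms])
  fix U V :: "L2 ^ 'n" and c :: real
  show "L2_vec_restrict I (U + V) = L2_vec_restrict I U + L2_vec_restrict I V"
    by (simp add: L2_vec_restrict_def vec_eq_iff add)
  show "L2_vec_restrict I (c *\<^sub>R U) = c *\<^sub>R L2_vec_restrict I U"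
    by (simp add: L2_vec_restrict_def vec_eq_iff scaleR)
  show "norm (L2_vec_restrict I U) \<le> norm U * 1"
    by (simp add: L2_vec_restrict_def norm_vec_def L2_set_mono norm_L2_restrict_le[OF assms])
qed

lemma L2_vec_restrict_in_power: "L2_vec_restrict {a..b} U \<in> L2_power a b"
  by (simp add: L2_vec_restrict_def L2_power_def L2_restrict_in_interval)

lemma L2_vec_restrict_eq_self: "U \<in> L2_power a b \<Longrightarrow> L2_vec_restrict {a..b} U = U"
  by (simp add: L2_vec_restrict_def L2_power_def L2_restrict_eq_self vec_eq_iff)

lemma inner_L2_vec_restrict_commute:
  "I \<in> sets borel \<Longrightarrow> L2_vec_restrict I U \<bullet> V = U \<bullet> L2_vec_restrict I V"
  by (simp add: L2_vec_restrict_def inner_vec_def inner_L2_restrict_commute)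

lemma bounded_linear_extension:
  fixes S :: "L2 ^ 'n \<Rightarrow> 'b::real_normed_vector"
  assumes "bounded_linear_on (L2_power a b) S"
  shows "bounded_linear (\<lambda>x. S (L2_vec_restrict {a..b} x))"
proof -
  let ?P = "L2_vec_restrict {a..b} :: L2 ^ 'n \<Rightarrow> _"
  interpret P: bounded_linear ?P by (rule bounded_linear_L2_vec_restrict) simp
  obtain K where K: "\<And>x. x \<in> L2_power a b \<Longrightarrow> norm (S x) \<le> K * norm x"
    using assms unfolding bounded_linear_on_def by blast
  obtain K' where K': "\<And>x. norm (?P x) \<le> norm x * K'"
    using P.bounded by blast
  show ?thesis
  proof (rule bounded_linear_intro[where K = "\<bar>K\<bar> * K'"])
    fix x y :: "L2 ^ 'n" and c :: real
    show "S (?P (x + y)) = S (?P x) + S (?P y)"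
      using assms by (auto simp: bounded_linear_on_def P.add L2_vec_restrict_in_power)
    show "S (?P (c *\<^sub>R x)) = c *\<^sub>R S (?P x)"
      using assms by (auto simp: bounded_linear_on_def P.scaleR L2_vec_restrict_in_power)
    have "norm (S (?P x)) \<le> K * norm (?P x)" by (rule K[OF L2_vec_restrict_in_power])
    also have "\<dots> \<le> \<bar>K\<bar> * norm (?P x)" by (intro mult_right_mono) auto
    also have "\<dots> \<le> \<bar>K\<bar> * (norm x * K')" by (intro mult_left_mono K') auto
    finally show "norm (S (?P x)) \<le> norm x * (\<bar>K\<bar> * K')" by (simp add: mult_ac)
  qed
qed

text \<open>
  For a square-integrable kernel \<open>k\<close> this is a Hilbert--Schmidt integral operator. For almost every \<open>t\<close> the row \<open>k (t, \<cdot>)\<close> is square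
  integrable, so the integral exists and the Cauchy--Schwarz inequality bounds it by the norm of
  the row; on the exceptional null set the integral may take a default value.
\<close>

definition kernel_op :: "(real \<times> real \<Rightarrow> real) \<Rightarrow> L2 \<Rightarrow> L2" where
  "kernel_op k f = abs_L2 (\<lambda>t. \<integral>\<tau>. k (t, \<tau>) * L2_eval f \<tau> \<partial>lborel)"

context
  fixes k :: "real \<times> real \<Rightarrow> real"
  assumes k [measurable]: "k \<in> borel_measurable borel"
    and int_k: "integrable lborel (\<lambda>x. (k x)\<^sup>2)"
begin

lemma measurable_kernel: "k \<in> borel_measurable (borel \<Otimes>\<^sub>M borel)"
  using k by (simp add: borel_prod)

lemma AE_square_integrable_kernel: "AE t in lborel. square_integrable (\<lambda>\<tau>. k (t, \<tau>))"
proof -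
  have "integrable (lborel \<Otimes>\<^sub>M lborel) (\<lambda>x. (k x)\<^sup>2)"
    using int_k by (simp add: lborel_prod)
  from lborel_pair.AE_integrable_fst'[OF this] show ?thesis
    by (simp add: square_integrable_def)
qed

lemma integrable_kernel_rows: "integrable lborel (\<lambda>t. \<integral>\<tau>. (k (t, \<tau>))\<^sup>2 \<partial>lborel)"
  and integral_kernel_rows:
    "(\<integral>t. (\<integral>\<tau>. (k (t, \<tau>))\<^sup>2 \<partial>lborel) \<partial>lborel) = (\<integral>x. (k x)\<^sup>2 \<partial>lborel)"
proof -
  have "integrable (lborel \<Otimes>\<^sub>M lborel) (\<lambda>x. (k x)\<^sup>2)"
    using int_k by (simp add: lborel_prod)
  from lborel_pair.integrable_fst'[OF this] lborel_pair.integral_fst'[OF this]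
  show "integrable lborel (\<lambda>t. \<integral>\<tau>. (k (t, \<tau>))\<^sup>2 \<partial>lborel)"
    "(\<integral>t. (\<integral>\<tau>. (k (t, \<tau>))\<^sup>2 \<partial>lborel) \<partial>lborel) = (\<integral>x. (k x)\<^sup>2 \<partial>lborel)"
    by (simp_all add: lborel_prod)
qed

lemma AE_kernel_op_bound:
  "AE t in lborel. (\<integral>\<tau>. k (t, \<tau>) * L2_eval f \<tau> \<partial>lborel)\<^sup>2 \<le> (\<integral>\<tau>. (k (t, \<tau>))\<^sup>2 \<partial>lborel) * (norm f)\<^sup>2"
  using AE_square_integrable_kernel
proof eventually_elim
  fix t assume t: "square_integrable (\<lambda>\<tau>. k (t, \<tau>))"
  have "\<bar>\<integral>\<tau>. k (t, \<tau>) * L2_eval f \<tau> \<partial>lborel\<bar>\<^sup>2 \<le> (norm (abs_L2 (\<lambda>\<tau>. k (t, \<tau>))) * norm f)\<^sup>2"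
    using abs_integral_mult_le[OF t square_integrable_L2_eval, of f] by (intro power_mono) auto
  then show "(\<integral>\<tau>. k (t, \<tau>) * L2_eval f \<tau> \<partial>lborel)\<^sup>2 \<le> (\<integral>\<tau>. (k (t, \<tau>))\<^sup>2 \<partial>lborel) * (norm f)\<^sup>2"
    by (simp add: power_mult_distrib norm_abs_L2_sq[OF t])
qed

lemma measurable_kernel_op:
  "(\<lambda>t. \<integral>\<tau>. k (t, \<tau>) * L2_eval f \<tau> \<partial>lborel) \<in> borel_measurable borel"
  using measurable_kernel by measurable

lemma square_integrable_kernel_op:
  "square_integrable (\<lambda>t. \<integral>\<tau>. k (t, \<tau>) * L2_eval f \<tau> \<partial>lborel)"
proof -
  have "integrable lborel (\<lambda>t. (\<integral>\<tau>. k (t, \<tau>) * L2_eval f \<tau> \<partial>lborel)\<^sup>2)"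
  proof (rule Bochner_Integration.integrable_bound)
    show "integrable lborel (\<lambda>t. (\<integral>\<tau>. (k (t, \<tau>))\<^sup>2 \<partial>lborel) * (norm f)\<^sup>2)"
      using integrable_kernel_rows by simp
    show "AE t in lborel. norm ((\<integral>\<tau>. k (t, \<tau>) * L2_eval f \<tau> \<partial>lborel)\<^sup>2)
        \<le> norm ((\<integral>\<tau>. (k (t, \<tau>))\<^sup>2 \<partial>lborel) * (norm f)\<^sup>2)"
      using AE_kernel_op_bound by eventually_elim auto
  qed (use measurable_kernel_op in simp)
  then show ?thesis by (simp add: square_integrable_def measurable_kernel_op)
qed

lemma AE_L2_eval_kernel_op:
  "AE t in lborel. L2_eval (kernel_op k f) t = (\<integral>\<tau>. k (t, \<tau>) * L2_eval f \<tau> \<partial>lborel)"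
  unfolding kernel_op_def by (rule AE_L2_eval_abs[OF square_integrable_kernel_op])

lemma bounded_linear_kernel_op: "bounded_linear (kernel_op k)"
proof (rule bounded_linear_intro[where K = "sqrt (\<integral>x. (k x)\<^sup>2 \<partial>lborel)"])
  note [measurable] = measurable_kernel measurable_kernel_op
  fix f g :: L2 and c :: real
  show "kernel_op k (f + g) = kernel_op k f + kernel_op k g"
    unfolding kernel_op_def abs_L2_add[OF square_integrable_kernel_op square_integrable_kernel_op, symmetric]
  proof (rule abs_L2_cong_AE[OF square_integrable_kernel_op])
    show "AE t in lborel. (\<integral>\<tau>. k (t, \<tau>) * L2_eval (f + g) \<tau> \<partial>lborel) =
        (\<integral>\<tau>. k (t, \<tau>) * L2_eval f \<tau> \<partial>lborel) + (\<integral>\<tau>. k (t, \<tau>) * L2_eval g \<tau> \<partial>lborel)"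
      using AE_square_integrable_kernel
    proof eventually_elim
      fix t assume t: "square_integrable (\<lambda>\<tau>. k (t, \<tau>))"
      have "(\<integral>\<tau>. k (t, \<tau>) * L2_eval (f + g) \<tau> \<partial>lborel) =
          (\<integral>\<tau>. k (t, \<tau>) * L2_eval f \<tau> + k (t, \<tau>) * L2_eval g \<tau> \<partial>lborel)"
      proof (rule integral_cong_AE)
        show "AE \<tau> in lborel. k (t, \<tau>) * L2_eval (f + g) \<tau> = k (t, \<tau>) * L2_eval f \<tau> + k (t, \<tau>) * L2_eval g \<tau>"
          using AE_L2_eval_add[of f g] by eventually_elim (simp add: distrib_left)
      qed measurable
      also have "\<dots> = (\<integral>\<tau>. k (t, \<tau>) * L2_eval f \<tau> \<partial>lborel) + (\<integral>\<tau>. k (t, \<tau>) * L2_eval g \<tau> \<partial>lborel)"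
        by (intro Bochner_Integration.integral_add square_integrable_mult t square_integrable_L2_eval)
      finally show "(\<integral>\<tau>. k (t, \<tau>) * L2_eval (f + g) \<tau> \<partial>lborel) =
          (\<integral>\<tau>. k (t, \<tau>) * L2_eval f \<tau> \<partial>lborel) + (\<integral>\<tau>. k (t, \<tau>) * L2_eval g \<tau> \<partial>lborel)" .
    qed
  qed measurable
  show "kernel_op k (c *\<^sub>R f) = c *\<^sub>R kernel_op k f"
    unfolding kernel_op_def abs_L2_scale[OF square_integrable_kernel_op, symmetric]
  proof (rule arg_cong[where f = abs_L2], rule ext)
    fix t
    have "(\<integral>\<tau>. k (t, \<tau>) * L2_eval (c *\<^sub>R f) \<tau> \<partial>lborel) = (\<integral>\<tau>. c * (k (t, \<tau>) * L2_eval f \<tau>) \<partial>lborel)"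
    proof (rule integral_cong_AE)
      show "AE \<tau> in lborel. k (t, \<tau>) * L2_eval (c *\<^sub>R f) \<tau> = c * (k (t, \<tau>) * L2_eval f \<tau>)"
        using AE_L2_eval_scale[of c f] by eventually_elim simp
    qed measurable
    then show "(\<integral>\<tau>. k (t, \<tau>) * L2_eval (c *\<^sub>R f) \<tau> \<partial>lborel) = c * (\<integral>\<tau>. k (t, \<tau>) * L2_eval f \<tau> \<partial>lborel)"
      by simp
  qed
  show "norm (kernel_op k f) \<le> norm f * sqrt (\<integral>x. (k x)\<^sup>2 \<partial>lborel)"
  proof (rule power2_le_imp_le)
    have "(norm (kernel_op k f))\<^sup>2 \<le> (\<integral>t. (\<integral>\<tau>. (k (t, \<tau>))\<^sup>2 \<partial>lborel) * (norm f)\<^sup>2 \<partial>lborel)"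
      unfolding kernel_op_def norm_abs_L2_sq[OF square_integrable_kernel_op]
      using square_integrable_kernel_op[of f] integrable_kernel_rows AE_kernel_op_bound[of f]
      by (intro integral_mono_AE) (auto simp: square_integrable_def)
    then show "(norm (kernel_op k f))\<^sup>2 \<le> (norm f * sqrt (\<integral>x. (k x)\<^sup>2 \<partial>lborel))\<^sup>2"
      by (simp add: power_mult_distrib integral_kernel_rows mult.commute)
  qed simp
qed

end

definition zero_extended_kernel :: "real \<Rightarrow> real \<Rightarrow> (real \<times> real \<Rightarrow> real) \<Rightarrow> real \<times> real \<Rightarrow> real" where
  "zero_extended_kernel a b k x = indicator ({a..b} \<times> {a..b}) x * k x"

text \<open>
  The class of \<open>t \<mapsto> u\<^sub>0(t) - \<integral> \<Sum>\<^sub>i \<beta>\<^sub>i(t, \<tau>) u\<^sub>i(\<tau>) d\<tau>\<close> on \<open>[a, b]\<close>, with \<open>u\<^sub>0\<close> the response. It is written as a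
  sum of operators, which makes boundedness and linearity immediate; that its norm is the integral
  appearing in the risk is \<open>norm_residual_op_sq\<close>.
\<close>

definition residual_op ::
  "real \<Rightarrow> real \<Rightarrow> ('p::finite \<Rightarrow> real \<times> real \<Rightarrow> real) \<Rightarrow> L2 ^ ('p option) \<Rightarrow> L2" where
  "residual_op a b \<beta> u = L2_restrict {a..b} (u $ None) -
     (\<Sum>i\<in>UNIV. kernel_op (zero_extended_kernel a b (\<beta> i)) (u $ Some i))"

lemma measurable_zero_extended_kernel:
  assumes "k \<in> L2_square a b"
  shows "zero_extended_kernel a b k \<in> borel_measurable borel"
proof -
  have "zero_extended_kernel a b k = (\<lambda>x. indicator ({a..b} \<times> {a..b}) x *\<^sub>R k x)"
    by (simp add: zero_extended_kernel_def fun_eq_iff)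
  moreover have "(\<lambda>x. indicator ({a..b} \<times> {a..b}) x *\<^sub>R k x) \<in> borel_measurable lborel"
    using assms unfolding L2_square_def set_borel_measurable_def by blast
  ultimately show ?thesis
    using measurable_cong_sets[OF sets_lborel refl, of borel] by metis
qed

lemma integrable_zero_extended_kernel:
  assumes "k \<in> L2_square a b"
  shows "integrable lborel (\<lambda>x. (zero_extended_kernel a b k x)\<^sup>2)"
proof -
  have "(\<lambda>x. (zero_extended_kernel a b k x)\<^sup>2) = (\<lambda>x. indicator ({a..b} \<times> {a..b}) x *\<^sub>R (k x)\<^sup>2)"
    by (auto simp: indicator_def zero_extended_kernel_def)
  then show ?thesis using assms by (simp add: L2_square_def set_integrable_def)
qed

lemma bounded_linear_residual_op:
  fixes \<beta> :: "'p::finite \<Rightarrow> real \<times> real \<Rightarrow> real"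
  assumes \<beta>: "\<And>i. \<beta> i \<in> L2_square a b"
  shows "bounded_linear (residual_op a b \<beta>)"
proof -
  define k where "k i = zero_extended_kernel a b (\<beta> i)" for i
  have measurable_k: "k i \<in> borel_measurable borel" for i
    unfolding k_def by (rule measurable_zero_extended_kernel[OF \<beta>])
  have integrable_k: "integrable lborel (\<lambda>x. (k i x)\<^sup>2)" for i
    unfolding k_def by (rule integrable_zero_extended_kernel[OF \<beta>])
  have nth: "bounded_linear (\<lambda>u :: L2 ^ ('p option). u $ j)" for j
    by (rule bounded_linear_vec_nth)
  have restrict: "bounded_linear (L2_restrict {a..b})"
    by (rule bounded_linear_L2_restrict) simp
  have op: "bounded_linear (kernel_op (k i))" for i
    by (rule bounded_linear_kernel_op[OF measurable_k integrable_k])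
  have 1: "bounded_linear (\<lambda>u :: L2 ^ ('p option). L2_restrict {a..b} (u $ None))"
    using bounded_linear_compose[OF restrict nth[of None]] .
  have "bounded_linear (\<lambda>u :: L2 ^ ('p option). kernel_op (k i) (u $ Some i))" for i
    using bounded_linear_compose[OF op[of i] nth[of "Some i"]] .
  then have 2: "bounded_linear (\<lambda>u :: L2 ^ ('p option). \<Sum>i\<in>UNIV. kernel_op (k i) (u $ Some i))"
    by (rule bounded_linear_sum)
  have eq: "residual_op a b \<beta> = (\<lambda>u. L2_restrict {a..b} (u $ None) - (\<Sum>i\<in>UNIV. kernel_op (k i) (u $ Some i)))"
    by (simp add: residual_op_def k_def fun_eq_iff)
  show ?thesis
    unfolding eq using bounded_linear_sub[OF 1 2] .
qed

text \<open>
  The integral of the sum and the sum of the integrals may differ, through default values, where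
  some row of a kernel fails to be square integrable; this happens on a null set of \<open>t\<close> only.
\<close>

lemma norm_residual_op_sq:
  fixes \<beta> :: "'p::finite \<Rightarrow> real \<times> real \<Rightarrow> real"
  assumes \<beta>: "\<And>i. \<beta> i \<in> L2_square a b"
  shows "(norm (residual_op a b \<beta> u))\<^sup>2 = (LINT t:{a..b}|lborel.
     (L2_eval (u $ None) t - (LINT \<tau>:{a..b}|lborel. \<Sum>i\<in>UNIV. \<beta> i (t, \<tau>) * L2_eval (u $ Some i) \<tau>))\<^sup>2)"
proof -
  define k where "k i = zero_extended_kernel a b (\<beta> i)" for i
  have measurable_k: "k i \<in> borel_measurable borel" for i
    unfolding k_def by (rule measurable_zero_extended_kernel[OF \<beta>])
  have integrable_k: "integrable lborel (\<lambda>x. (k i x)\<^sup>2)" for i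
    unfolding k_def by (rule integrable_zero_extended_kernel[OF \<beta>])
  have [measurable]: "k i \<in> borel_measurable (borel \<Otimes>\<^sub>M borel)" for i
    unfolding borel_prod by (rule measurable_k)
  define r where "r t = indicator {a..b} t * (L2_eval (u $ None) t -
      (\<integral>\<tau>. (\<Sum>i\<in>UNIV. k i (t, \<tau>) * L2_eval (u $ Some i) \<tau>) \<partial>lborel))" for t
  have r_eq: "indicator {a..b} t *\<^sub>R (L2_eval (u $ None) t -
      (LINT \<tau>:{a..b}|lborel. \<Sum>i\<in>UNIV. \<beta> i (t, \<tau>) * L2_eval (u $ Some i) \<tau>))\<^sup>2 = (r t)\<^sup>2" for t
  proof (cases "t \<in> {a..b}")
    case True
    have "indicator {a..b} \<tau> *\<^sub>R (\<Sum>i\<in>UNIV. \<beta> i (t, \<tau>) * L2_eval (u $ Some i) \<tau>) =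
        (\<Sum>i\<in>UNIV. k i (t, \<tau>) * L2_eval (u $ Some i) \<tau>)" for \<tau>
      using True by (simp add: k_def zero_extended_kernel_def indicator_def)
    with True show ?thesis by (simp add: r_def set_lebesgue_integral_def)
  qed (simp add: r_def)
  have [measurable]: "r \<in> borel_measurable borel"
    unfolding r_def[abs_def] by measurable
  have rows: "AE t in lborel. \<forall>i. square_integrable (\<lambda>\<tau>. k i (t, \<tau>))"
    unfolding AE_all_countable
    by (intro allI AE_square_integrable_kernel measurable_k integrable_k)
  have ops: "AE t in lborel. \<forall>i. L2_eval (kernel_op (k i) (u $ Some i)) t =
      (\<integral>\<tau>. k i (t, \<tau>) * L2_eval (u $ Some i) \<tau> \<partial>lborel)"
    unfolding AE_all_countable
    by (intro allI AE_L2_eval_kernel_op measurable_k integrable_k)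
  have "AE t in lborel. L2_eval (L2_restrict {a..b} (u $ None)) t = indicator {a..b} t * L2_eval (u $ None) t"
    by (rule AE_L2_eval_restrict) simp
  with rows ops have "AE t in lborel. L2_eval (residual_op a b \<beta> u) t = r t"
    using AE_L2_eval_diff[of "L2_restrict {a..b} (u $ None)" "\<Sum>i\<in>UNIV. kernel_op (k i) (u $ Some i)"]
      AE_L2_eval_sum[OF finite_class.finite_UNIV, of "\<lambda>i. kernel_op (k i) (u $ Some i)"]
  proof eventually_elim
    fix t
    assume rows: "\<forall>i. square_integrable (\<lambda>\<tau>. k i (t, \<tau>))"
      and ev: "\<forall>i. L2_eval (kernel_op (k i) (u $ Some i)) t =
        (\<integral>\<tau>. k i (t, \<tau>) * L2_eval (u $ Some i) \<tau> \<partial>lborel)"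
        "L2_eval (L2_restrict {a..b} (u $ None)) t = indicator {a..b} t * L2_eval (u $ None) t"
        "L2_eval (L2_restrict {a..b} (u $ None) - (\<Sum>i\<in>UNIV. kernel_op (k i) (u $ Some i))) t =
         L2_eval (L2_restrict {a..b} (u $ None)) t - L2_eval (\<Sum>i\<in>UNIV. kernel_op (k i) (u $ Some i)) t"
        "L2_eval (\<Sum>i\<in>UNIV. kernel_op (k i) (u $ Some i)) t =
         (\<Sum>i\<in>UNIV. L2_eval (kernel_op (k i) (u $ Some i)) t)"
    have ext: "L2_eval (residual_op a b \<beta> u) t = indicator {a..b} t * L2_eval (u $ None) t -
        (\<Sum>i\<in>UNIV. \<integral>\<tau>. k i (t, \<tau>) * L2_eval (u $ Some i) \<tau> \<partial>lborel)"
      unfolding residual_op_def using ev by (simp add: k_def)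
    show "L2_eval (residual_op a b \<beta> u) t = r t"
    proof (cases "t \<in> {a..b}")
      case True
      have "(\<integral>\<tau>. (\<Sum>i\<in>UNIV. k i (t, \<tau>) * L2_eval (u $ Some i) \<tau>) \<partial>lborel) =
          (\<Sum>i\<in>UNIV. \<integral>\<tau>. k i (t, \<tau>) * L2_eval (u $ Some i) \<tau> \<partial>lborel)"
        by (intro Bochner_Integration.integral_sum square_integrable_mult square_integrable_L2_eval)
          (use rows in blast)
      with True ext show ?thesis by (simp add: r_def)
    next
      case False
      then have "k i (t, \<tau>) = 0" for i \<tau> by (auto simp: k_def zero_extended_kernel_def)
      with False ext show ?thesis by (simp add: r_def)
    qed
  qed
  then have ae: "AE t in lborel. (L2_eval (residual_op a b \<beta> u) t)\<^sup>2 = (r t)\<^sup>2"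
    by eventually_elim simp
  have "(norm (residual_op a b \<beta> u))\<^sup>2 = (\<integral>t. (r t)\<^sup>2 \<partial>lborel)"
    unfolding norm_L2_eval_sq by (rule integral_cong_AE[OF _ _ ae]) measurable
  then show ?thesis
    by (subst set_lebesgue_integral_def) (simp only: r_eq)
qed

section \<open>Norm and covariance form of a shift\<close>

lemma measurable_vec_nth_comp [measurable]:
  fixes U :: "'w \<Rightarrow> 'a::real_normed_vector ^ 'n"
  assumes "U \<in> borel_measurable M"
  shows "(\<lambda>w. U w $ i) \<in> borel_measurable M"
  using measurable_compose[OF assms borel_measurable_bounded_linear[OF bounded_linear_vec_nth]] .

lemma norm_vec_sq: "(norm (v :: 'a::real_normed_vector ^ 'n))\<^sup>2 = (\<Sum>i\<in>UNIV. (norm (v $ i))\<^sup>2)"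
  by (simp add: norm_vec_def L2_set_def sum_nonneg)

lemma nn_integral_L2_interval:
  assumes "f \<in> L2_interval a b"
  shows "(\<integral>\<^sup>+t. ennreal ((L2_eval f t)\<^sup>2) * indicator {a..b} t \<partial>lborel) = ennreal ((norm f)\<^sup>2)"
proof -
  have "(\<integral>\<^sup>+t. ennreal ((L2_eval f t)\<^sup>2) * indicator {a..b} t \<partial>lborel) =
      (\<integral>\<^sup>+t. ennreal ((indicator {a..b} t * L2_eval f t)\<^sup>2) \<partial>lborel)"
    by (intro nn_integral_cong) (auto simp: indicator_def)
  also have "\<dots> = ennreal ((norm (L2_restrict {a..b} f))\<^sup>2)"
    unfolding L2_restrict_def by (rule nn_integral_square_L2[OF square_integrable_restrict]) simp
  finally show ?thesis by (simp add: L2_restrict_eq_self[OF assms])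
qed

lemma shift_norm_sq_eq:
  assumes "prob_space M" and [measurable]: "U \<in> borel_measurable M"
    and U: "\<And>w. w \<in> space M \<Longrightarrow> U w \<in> L2_power a b"
  shows "shift_norm_sq a b M U = (\<integral>\<^sup>+w. ennreal ((norm (U w))\<^sup>2) \<partial>M)"
proof -
  interpret prob_space M by fact
  interpret P: pair_sigma_finite lborel M ..
  have "(\<integral>\<^sup>+t\<in>{a..b}. (\<integral>\<^sup>+w. ennreal ((L2_eval (U w $ i) t)\<^sup>2) \<partial>M) \<partial>lborel) =
      (\<integral>\<^sup>+w. ennreal ((norm (U w $ i))\<^sup>2) \<partial>M)" for i
  proof -
    have "(\<integral>\<^sup>+t\<in>{a..b}. (\<integral>\<^sup>+w. ennreal ((L2_eval (U w $ i) t)\<^sup>2) \<partial>M) \<partial>lborel) =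
        (\<integral>\<^sup>+t. (\<integral>\<^sup>+w. ennreal ((L2_eval (U w $ i) t)\<^sup>2) * indicator {a..b} t \<partial>M) \<partial>lborel)"
      by (simp add: nn_integral_multc)
    also have "\<dots> = (\<integral>\<^sup>+w. (\<integral>\<^sup>+t. ennreal ((L2_eval (U w $ i) t)\<^sup>2) * indicator {a..b} t \<partial>lborel) \<partial>M)"
      by (rule P.Fubini'[symmetric]) measurable
    also have "\<dots> = (\<integral>\<^sup>+w. ennreal ((norm (U w $ i))\<^sup>2) \<partial>M)"
      using U by (intro nn_integral_cong nn_integral_L2_interval) (auto simp: L2_power_def)
    finally show ?thesis .
  qed
  then have "shift_norm_sq a b M U = (\<Sum>i\<in>UNIV. \<integral>\<^sup>+w. ennreal ((norm (U w $ i))\<^sup>2) \<partial>M)"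
    by (simp add: shift_norm_sq_def)
  also have "\<dots> = (\<integral>\<^sup>+w. ennreal ((norm (U w))\<^sup>2) \<partial>M)"
    by (simp add: nn_integral_sum[symmetric] norm_vec_sq sum_ennreal)
  finally show ?thesis .
qed

lemma finite_second_moment_shift:
  assumes "prob_space M" "U \<in> shift_space a b M"
  shows "finite_second_moment M U"
proof -
  have [measurable]: "U \<in> borel_measurable M" using assms by (simp add: shift_space_def)
  have "(\<integral>\<^sup>+w. ennreal ((norm (U w))\<^sup>2) \<partial>M) < \<infinity>"
    using shift_norm_sq_eq[of M U a b] assms by (simp add: shift_space_def)
  then have "integrable M (\<lambda>w. (norm (U w))\<^sup>2)" by (intro integrableI_nonneg) auto
  then show ?thesis by (simp add: finite_second_moment_def)
qed

lemma (in pair_sigma_finite) integral_tensor: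
  fixes f g :: "_ \<Rightarrow> real"
  assumes f: "integrable M1 f" and g: "integrable M2 g"
  shows "integrable (M1 \<Otimes>\<^sub>M M2) (\<lambda>(x, y). f x * g y)"
    and "(\<integral>(x, y). f x * g y \<partial>(M1 \<Otimes>\<^sub>M M2)) = (\<integral>x. f x \<partial>M1) * (\<integral>y. g y \<partial>M2)"
proof -
  have [measurable]: "f \<in> borel_measurable M1" "g \<in> borel_measurable M2" using f g by auto
  show int: "integrable (M1 \<Otimes>\<^sub>M M2) (\<lambda>(x, y). f x * g y)"
    by (rule Fubini_integrable) (use f g in \<open>auto simp: abs_mult\<close>)
  show "(\<integral>(x, y). f x * g y \<partial>(M1 \<Otimes>\<^sub>M M2)) = (\<integral>x. f x \<partial>M1) * (\<integral>y. g y \<partial>M2)"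
    using integral_fst'[OF int] by simp
qed

text \<open>
  Pointwise, the integrand is a double sum of expectations of products \<open>f\<^sub>i(s) f\<^sub>j(t)\<close> with
  \<open>f\<^sub>i(t) = A\<^sub>t(i) g\<^sub>t(i)\<close>. Exchanging expectation and integration turns each into the expectation of
  \<open>\<langle>A(i), g(i)\<rangle> \<langle>A(j), g(j)\<rangle>\<close>, and these sum to a square.
\<close>

lemma shift_form_eq:
  fixes A :: "'w \<Rightarrow> L2 ^ 'n"
  assumes "prob_space M" and A: "A \<in> shift_space a b M"
  shows "shift_form a b M A g = (\<integral>w. (A w \<bullet> g)\<^sup>2 \<partial>M)"
proof -
  interpret prob_space M by fact
  interpret P: pair_sigma_finite M "lborel \<Otimes>\<^sub>M lborel :: (real \<times> real) measure"
    unfolding lborel_prod ..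
  have [measurable]: "A \<in> borel_measurable M" using A by (simp add: shift_space_def)
  have ss: "integrable M (\<lambda>w. (norm (A w))\<^sup>2)"
    using finite_second_moment_shift[OF assms] by (simp add: finite_second_moment_def)
  define f where "f i w t = indicator {a..b} t * L2_eval (A w $ i) t * L2_eval (g $ i) t" for i w t
  have [measurable]: "(\<lambda>x. f i (h x) (k x)) \<in> borel_measurable N"
    if "h \<in> N \<rightarrow>\<^sub>M M" "k \<in> N \<rightarrow>\<^sub>M borel" for i h k and N :: "'c measure"
    using that unfolding f_def by measurable
  have f_int: "integrable lborel (f i w)" for i w
    unfolding f_def[abs_def] by (intro square_integrable_mult square_integrable_restrict square_integrable_L2_eval) simp
  have f_abs: "(\<integral>t. \<bar>f i w t\<bar> \<partial>lborel) \<le> norm (A w) * norm g" for i w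
  proof -
    have "(\<integral>t. \<bar>f i w t\<bar> \<partial>lborel) \<le> norm (L2_restrict {a..b} (A w $ i)) * norm (g $ i)"
      using integral_abs_mult_le[OF square_integrable_restrict square_integrable_L2_eval, of "{a..b}" "A w $ i" "g $ i"]
      by (simp add: f_def L2_restrict_def)
    also have "\<dots> \<le> norm (A w) * norm g"
      by (intro mult_mono order.trans[OF norm_L2_restrict_le] Finite_Cartesian_Product.norm_nth_le) auto
    finally show ?thesis .
  qed
  have f_inner: "A w \<bullet> g = (\<Sum>i\<in>UNIV. \<integral>t. f i w t \<partial>lborel)" if "w \<in> space M" for w
  proof -
    have "A w \<in> L2_power a b" using A that by (simp add: shift_space_def)
    then have "L2_restrict {a..b} (A w $ i) = A w $ i" for i
      by (simp add: L2_power_def L2_restrict_eq_self)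
    then have "A w $ i \<bullet> g $ i = (\<integral>t. f i w t \<partial>lborel)" for i
      using inner_L2_restrict[of "{a..b}" "A w $ i" "g $ i"] by (simp add: f_def)
    then show ?thesis by (simp add: inner_vec_def)
  qed
  have tensor: "integrable (lborel \<Otimes>\<^sub>M lborel) (\<lambda>(s, t). f i w s * f j w t)"
      "(\<integral>(s, t). f i w s * f j w t \<partial>(lborel \<Otimes>\<^sub>M lborel)) = (\<integral>t. f i w t \<partial>lborel) * (\<integral>t. f j w t \<partial>lborel)"
      "(\<integral>(s, t). \<bar>f i w s\<bar> * \<bar>f j w t\<bar> \<partial>(lborel \<Otimes>\<^sub>M lborel)) = (\<integral>t. \<bar>f i w t\<bar> \<partial>lborel) * (\<integral>t. \<bar>f j w t\<bar> \<partial>lborel)"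
    for i j w
    using lborel_pair.integral_tensor[OF f_int[of i w] f_int[of j w]]
      lborel_pair.integral_tensor(2)[OF integrable_abs[OF f_int[of i w]] integrable_abs[OF f_int[of j w]]] by auto
  \<comment> \<open>Integrability for the exchange comes from the bound \<open>\<parallel>A\<parallel>\<^sup>2 \<parallel>g\<parallel>\<^sup>2\<close> on the inner integral of the absolute value.\<close>
  have int: "integrable (M \<Otimes>\<^sub>M (lborel \<Otimes>\<^sub>M lborel)) (\<lambda>(w, s, t). f i w s * f j w t)" for i j
  proof (rule P.Fubini_integrable)
    show "(\<lambda>(w, s, t). f i w s * f j w t) \<in> borel_measurable (M \<Otimes>\<^sub>M (lborel \<Otimes>\<^sub>M lborel))"
      unfolding split_beta' by measurable
    show "AE w in M. integrable (lborel \<Otimes>\<^sub>M lborel) (\<lambda>y. case (w, y) of (w, s, t) \<Rightarrow> f i w s * f j w t)"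
      using tensor(1) by simp
    have "integrable M (\<lambda>w. (\<integral>t. \<bar>f i w t\<bar> \<partial>lborel) * (\<integral>t. \<bar>f j w t\<bar> \<partial>lborel))"
    proof (rule Bochner_Integration.integrable_bound)
      show "integrable M (\<lambda>w. (norm (A w))\<^sup>2 * (norm g)\<^sup>2)" using ss by simp
      show "(\<lambda>w. (\<integral>t. \<bar>f i w t\<bar> \<partial>lborel) * (\<integral>t. \<bar>f j w t\<bar> \<partial>lborel)) \<in> borel_measurable M"
        by measurable
      show "AE w in M. norm ((\<integral>t. \<bar>f i w t\<bar> \<partial>lborel) * (\<integral>t. \<bar>f j w t\<bar> \<partial>lborel)) \<le> norm ((norm (A w))\<^sup>2 * (norm g)\<^sup>2)"
      proof (rule AE_I2)
        fix w
        have "(\<integral>t. \<bar>f i w t\<bar> \<partial>lborel) * (\<integral>t. \<bar>f j w t\<bar> \<partial>lborel) \<le> (norm (A w) * norm g) * (norm (A w) * norm g)"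
          by (intro mult_mono f_abs) auto
        then show "norm ((\<integral>t. \<bar>f i w t\<bar> \<partial>lborel) * (\<integral>t. \<bar>f j w t\<bar> \<partial>lborel)) \<le> norm ((norm (A w))\<^sup>2 * (norm g)\<^sup>2)"
          by (simp add: abs_mult power2_eq_square mult_ac)
      qed
    qed
    then show "integrable M (\<lambda>w. \<integral>y. norm (case (w, y) of (w, s, t) \<Rightarrow> f i w s * f j w t) \<partial>(lborel \<Otimes>\<^sub>M lborel))"
      unfolding tensor(3)[symmetric] by (simp add: split_beta' abs_mult)
  qed
  have int2: "integrable (lborel \<Otimes>\<^sub>M lborel) (\<lambda>x. \<integral>w. f i w (fst x) * f j w (snd x) \<partial>M)"
    and swap: "(\<integral>x. (\<integral>w. f i w (fst x) * f j w (snd x) \<partial>M) \<partial>(lborel \<Otimes>\<^sub>M lborel)) =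
      (\<integral>w. (\<integral>t. f i w t \<partial>lborel) * (\<integral>t. f j w t \<partial>lborel) \<partial>M)"
    and int3: "integrable M (\<lambda>w. (\<integral>t. f i w t \<partial>lborel) * (\<integral>t. f j w t \<partial>lborel))" for i j
  proof -
    have *: "integrable (M \<Otimes>\<^sub>M (lborel \<Otimes>\<^sub>M lborel)) (\<lambda>(w, x). f i w (fst x) * f j w (snd x))"
      using int[of i j] by (simp add: split_beta')
    show "integrable (lborel \<Otimes>\<^sub>M lborel) (\<lambda>x. \<integral>w. f i w (fst x) * f j w (snd x) \<partial>M)"
      using P.integrable_snd[OF *] .
    show "(\<integral>x. (\<integral>w. f i w (fst x) * f j w (snd x) \<partial>M) \<partial>(lborel \<Otimes>\<^sub>M lborel)) =
      (\<integral>w. (\<integral>t. f i w t \<partial>lborel) * (\<integral>t. f j w t \<partial>lborel) \<partial>M)"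
      using P.Fubini_integral[OF *] tensor(2)[of i _ j] by (simp add: split_beta')
    show "integrable M (\<lambda>w. (\<integral>t. f i w t \<partial>lborel) * (\<integral>t. f j w t \<partial>lborel))"
      using P.integrable_fst[OF *] tensor(2)[of i _ j] by (simp add: split_beta')
  qed
  have "shift_form a b M A g = (\<integral>x. (\<Sum>i\<in>UNIV. \<Sum>j\<in>UNIV. \<integral>w. f i w (fst x) * f j w (snd x) \<partial>M) \<partial>(lborel \<Otimes>\<^sub>M lborel))"
    unfolding shift_form_def set_lebesgue_integral_def lborel_prod
  proof (rule Bochner_Integration.integral_cong[OF refl])
    fix x :: "real \<times> real"
    obtain s t where x: "x = (s, t)" by (cases x)
    have K: "(\<integral>w. f i w s * f j w t \<partial>M) = indicator ({a..b} \<times> {a..b}) x *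
        (L2_eval (g $ i) s * shift_kernel M A s t $ i $ j * L2_eval (g $ j) t)" for i j
    proof -
      have "(\<integral>w. f i w s * f j w t \<partial>M) = (\<integral>w. (indicator ({a..b} \<times> {a..b}) x * L2_eval (g $ i) s * L2_eval (g $ j) t) *
          (L2_eval (A w $ i) s * L2_eval (A w $ j) t) \<partial>M)"
        by (intro Bochner_Integration.integral_cong) (auto simp: f_def x indicator_def)
      also have "\<dots> = (indicator ({a..b} \<times> {a..b}) x * L2_eval (g $ i) s * L2_eval (g $ j) t) * shift_kernel M A s t $ i $ j"
        by (simp only: integral_mult_right_zero) (simp add: shift_kernel_def)
      finally show ?thesis by (simp only: mult_ac)
    qed
    show "indicator ({a..b} \<times> {a..b}) x *\<^sub>R (case x of (s, t) \<Rightarrow> (L2_vec_eval g s v* shift_kernel M A s t) \<bullet> L2_vec_eval g t)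
      = (\<Sum>i\<in>UNIV. \<Sum>j\<in>UNIV. \<integral>w. f i w (fst x) * f j w (snd x) \<partial>M)"
      unfolding x fst_conv snd_conv K[unfolded x]
      by (subst sum.swap) (simp add: inner_vec_def vector_matrix_mult_def L2_vec_eval_def sum_distrib_left sum_distrib_right mult_ac)
  qed
  also have "\<dots> = (\<Sum>i\<in>UNIV. \<Sum>j\<in>UNIV. \<integral>w. (\<integral>t. f i w t \<partial>lborel) * (\<integral>t. f j w t \<partial>lborel) \<partial>M)"
    by (simp add: Bochner_Integration.integral_sum int2 swap Bochner_Integration.integrable_sum)
  also have "\<dots> = (\<integral>w. (\<Sum>i\<in>UNIV. \<Sum>j\<in>UNIV. (\<integral>t. f i w t \<partial>lborel) * (\<integral>t. f j w t \<partial>lborel)) \<partial>M)"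
    by (simp add: Bochner_Integration.integral_sum int3 Bochner_Integration.integrable_sum)
  also have "\<dots> = (\<integral>w. (A w \<bullet> g)\<^sup>2 \<partial>M)"
    by (intro Bochner_Integration.integral_cong) (auto simp: f_inner power2_eq_square sum_product)
  finally show ?thesis .
qed

section \<open>Risk of an environment\<close>

lemma finite_second_moment_add:
  fixes X Y :: "'w \<Rightarrow> 'a::{real_normed_vector, second_countable_topology}"
  assumes "finite_second_moment M X" "finite_second_moment M Y"
  shows "finite_second_moment M (\<lambda>w. X w + Y w)"
proof -
  have [measurable]: "X \<in> borel_measurable M" "Y \<in> borel_measurable M"
    using assms by (auto simp: finite_second_moment_def)
  have *: "(norm (x + y))\<^sup>2 \<le> 2 * (norm x)\<^sup>2 + 2 * (norm y)\<^sup>2" for x y :: 'a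
  proof -
    have "(norm (x + y))\<^sup>2 \<le> (norm x + norm y)\<^sup>2"
      by (intro power_mono norm_triangle_ineq) auto
    also have "\<dots> \<le> 2 * (norm x)\<^sup>2 + 2 * (norm y)\<^sup>2"
      using sum_squares_bound[of "norm x" "norm y"] by (simp add: power2_sum)
    finally show ?thesis .
  qed
  have "integrable M (\<lambda>w. (norm (X w + Y w))\<^sup>2)"
  proof (rule Bochner_Integration.integrable_bound)
    show "integrable M (\<lambda>w. 2 * (norm (X w))\<^sup>2 + 2 * (norm (Y w))\<^sup>2)"
      using assms by (simp add: finite_second_moment_def)
    show "AE w in M. norm ((norm (X w + Y w))\<^sup>2) \<le> norm (2 * (norm (X w))\<^sup>2 + 2 * (norm (Y w))\<^sup>2)"
      using * by (intro AE_I2) (simp add: abs_of_nonneg)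
  qed simp
  then show ?thesis by (simp add: finite_second_moment_def)
qed

lemma finite_second_moment_diff:
  fixes X Y :: "'w \<Rightarrow> 'a::{real_normed_vector, second_countable_topology}"
  assumes "finite_second_moment M X" "finite_second_moment M Y"
  shows "finite_second_moment M (\<lambda>w. X w - Y w)"
  using finite_second_moment_add[OF assms(1) finite_second_moment_bounded_linear[OF bounded_linear_minus[OF bounded_linear_ident] assms(2)]]
  by simp

lemma integrable_inner_finite_second_moment:
  fixes X Y :: "'w \<Rightarrow> 'a::{real_inner, second_countable_topology}"
  assumes "finite_second_moment M X" "finite_second_moment M Y"
  shows "integrable M (\<lambda>w. X w \<bullet> Y w)"
proof (rule Bochner_Integration.integrable_bound)
  have [measurable]: "X \<in> borel_measurable M" "Y \<in> borel_measurable M"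
    using assms by (auto simp: finite_second_moment_def)
  show "integrable M (\<lambda>w. (norm (X w))\<^sup>2 + (norm (Y w))\<^sup>2)"
    using assms by (simp add: finite_second_moment_def)
  show "(\<lambda>w. X w \<bullet> Y w) \<in> borel_measurable M" by measurable
  show "AE w in M. norm (X w \<bullet> Y w) \<le> norm ((norm (X w))\<^sup>2 + (norm (Y w))\<^sup>2)"
  proof (rule AE_I2)
    fix w
    have "\<bar>X w \<bullet> Y w\<bar> \<le> norm (X w) * norm (Y w)" by (rule Cauchy_Schwarz_ineq2)
    moreover have "2 * norm (X w) * norm (Y w) \<le> (norm (X w))\<^sup>2 + (norm (Y w))\<^sup>2"
      by (rule sum_squares_bound)
    moreover have "0 \<le> norm (X w) * norm (Y w)" by simp
    ultimately show "norm (X w \<bullet> Y w) \<le> norm ((norm (X w))\<^sup>2 + (norm (Y w))\<^sup>2)" by simp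
  qed
qed

lemma integral_norm_add_sq:
  fixes X Y :: "'w \<Rightarrow> 'a::{real_inner, second_countable_topology}"
  assumes "finite_second_moment M X" "finite_second_moment M Y"
  shows "(\<integral>w. (norm (X w + Y w))\<^sup>2 \<partial>M) =
    (\<integral>w. (norm (X w))\<^sup>2 \<partial>M) + 2 * (\<integral>w. X w \<bullet> Y w \<partial>M) + (\<integral>w. (norm (Y w))\<^sup>2 \<partial>M)"
proof -
  have "(norm (x + y))\<^sup>2 = (norm x)\<^sup>2 + 2 * (x \<bullet> y) + (norm y)\<^sup>2" for x y :: 'a
    by (simp add: power2_norm_eq_inner inner_add inner_commute)
  then show ?thesis
    using assms integrable_inner_finite_second_moment[OF assms] by (simp add: finite_second_moment_def)
qed

lemma (in prob_space) integrable_finite_second_moment: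
  fixes X :: "'a \<Rightarrow> 'b::{banach, second_countable_topology}"
  assumes "finite_second_moment M X"
  shows "integrable M X"
proof (rule Bochner_Integration.integrable_bound)
  show "integrable M (\<lambda>w. 1 + (norm (X w))\<^sup>2)" using assms by (simp add: finite_second_moment_def)
  show "AE w in M. norm (X w) \<le> norm (1 + (norm (X w))\<^sup>2)"
  proof (rule AE_I2)
    fix w
    have "2 * 1 * norm (X w) \<le> 1\<^sup>2 + (norm (X w))\<^sup>2" by (rule sum_squares_bound)
    then have "norm (X w) \<le> 1 + (norm (X w))\<^sup>2" unfolding one_power2 using norm_ge_zero[of "X w"] by linarith
    then show "norm (X w) \<le> norm (1 + (norm (X w))\<^sup>2)" by simp
  qed
qed (use assms in \<open>simp add: finite_second_moment_def\<close>)

text \<open>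
  The joint law is a product, so integrating over \<open>X\<close> first leaves the inner product of \<open>Y\<close> with
  the mean of \<open>X\<close>.
\<close>

lemma (in prob_space) expectation_inner_indep_centred:
  fixes X Y :: "'a \<Rightarrow> 'b::{real_inner, banach, second_countable_topology}"
  assumes indep: "indep_var borel X borel Y"
    and X: "finite_second_moment M X" and Y: "finite_second_moment M Y" and mean: "expectation X = 0"
  shows "expectation (\<lambda>w. X w \<bullet> Y w) = 0"
proof -
  have [measurable]: "X \<in> borel_measurable M" "Y \<in> borel_measurable M"
    using X Y by (auto simp: finite_second_moment_def)
  let ?P = "distr M borel X" and ?Q = "distr M borel Y"
  interpret P: prob_space ?P by (rule prob_space_distr) simp
  interpret Q: prob_space ?Q by (rule prob_space_distr) simp
  interpret PQ: pair_sigma_finite ?P ?Q ..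
  have eq: "?P \<Otimes>\<^sub>M ?Q = distr M (borel \<Otimes>\<^sub>M borel) (\<lambda>w. (X w, Y w))"
    using indep by (simp add: indep_var_distribution_eq)
  have m: "(\<lambda>z. fst z \<bullet> snd z) \<in> borel_measurable (borel \<Otimes>\<^sub>M borel :: ('b \<times> 'b) measure)"
    by measurable
  have XY: "(\<lambda>w. (X w, Y w)) \<in> M \<rightarrow>\<^sub>M borel \<Otimes>\<^sub>M borel" by measurable
  have int: "integrable (?P \<Otimes>\<^sub>M ?Q) (\<lambda>z. fst z \<bullet> snd z)"
    unfolding eq using integrable_inner_finite_second_moment[OF X Y] by (simp add: integrable_distr_eq[OF XY m])
  have "integrable ?P (\<lambda>x. x)"
    using integrable_finite_second_moment[OF X] by (simp add: integrable_distr_eq)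
  moreover have "(\<integral>x. x \<partial>?P) = 0"
    using mean by (simp add: integral_distr)
  ultimately have inner0: "(\<integral>x. x \<bullet> y \<partial>?P) = 0" for y
    by simp
  have "expectation (\<lambda>w. X w \<bullet> Y w) = (\<integral>z. fst z \<bullet> snd z \<partial>(?P \<Otimes>\<^sub>M ?Q))"
    unfolding eq by (simp add: integral_distr[OF XY m])
  also have "\<dots> = (\<integral>y. (\<integral>x. x \<bullet> y \<partial>?P) \<partial>?Q)"
    using PQ.integral_snd[of "\<lambda>x y. x \<bullet> y"] int by (simp add: split_beta')
  finally show ?thesis by (simp add: inner0)
qed

lemma L2_power_add:
  assumes "U \<in> L2_power a b" "V \<in> L2_power a b"
  shows "U + V \<in> L2_power a b"
proof -
  interpret bounded_linear "L2_vec_restrict {a..b} :: L2 ^ 'a \<Rightarrow> _"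
    by (rule bounded_linear_L2_vec_restrict) simp
  have "L2_vec_restrict {a..b} (U + V) = U + V"
    using assms by (simp add: add L2_vec_restrict_eq_self)
  then show ?thesis using L2_vec_restrict_in_power by metis
qed

lemma L2_power_scaleR:
  assumes "U \<in> L2_power a b"
  shows "c *\<^sub>R U \<in> L2_power a b"
proof -
  interpret bounded_linear "L2_vec_restrict {a..b} :: L2 ^ 'a \<Rightarrow> _"
    by (rule bounded_linear_L2_vec_restrict) simp
  have "L2_vec_restrict {a..b} (c *\<^sub>R U) = c *\<^sub>R U"
    using assms by (simp add: scaleR L2_vec_restrict_eq_self)
  then show ?thesis using L2_vec_restrict_in_power by metis
qed

definition prediction_error_op ::
  "real \<Rightarrow> real \<Rightarrow> (L2 ^ ('p option) \<Rightarrow> L2 ^ ('p option)) \<Rightarrow> ('p::finite \<Rightarrow> real \<times> real \<Rightarrow> real) \<Rightarrow>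
     L2 ^ ('p option) \<Rightarrow> L2" where
  "prediction_error_op a b S \<beta> x = residual_op a b \<beta> (S (L2_vec_restrict {a..b} x))"

lemma bounded_linear_prediction_error_op:
  assumes "bounded_linear_on (L2_power a b) S" "\<And>i. \<beta> i \<in> L2_square a b"
  shows "bounded_linear (prediction_error_op a b S \<beta>)"
  using bounded_linear_compose[OF bounded_linear_residual_op[OF assms(2)] bounded_linear_extension[OF assms(1)]]
  by (simp add: prediction_error_op_def[abs_def])

text \<open>
  The prediction error is linear in the shift and the noise, whose contributions are independent;
  the one of the noise is centred because a bounded linear map commutes with the Bochner
  integral. Hence the cross term of the square vanishes. What remains depends only on the laws of
  \<open>B\<close> and \<open>\<epsilon>\<close>, so that the extension \<open>N\<close> disappears.
\<close>

lemma risk_eq: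
  fixes B \<epsilon> :: "'w \<Rightarrow> L2 ^ ('p::finite option)" and e :: "'e \<Rightarrow> L2 ^ ('p option)"
  assumes M: "prob_space M" and ext: "noise_extension a b M \<epsilon> B N \<pi> e"
    and B: "B \<in> shift_space a b M" and \<epsilon>: "\<epsilon> \<in> shift_space a b M"
    and mean: "has_bochner_integral M \<epsilon> 0"
    and S: "bounded_linear_on (L2_power a b) S" and \<beta>: "\<And>i. \<beta> i \<in> L2_square a b"
  defines "L \<equiv> prediction_error_op a b S \<beta>"
  shows "risk a b S N (\<lambda>x. B (\<pi> x)) e \<beta> = (\<integral>w. (norm (L (B w)))\<^sup>2 \<partial>M) + (\<integral>w. (norm (L (\<epsilon> w)))\<^sup>2 \<partial>M)"
proof -
  have N: "prob_space N" and \<pi> [measurable]: "\<pi> \<in> N \<rightarrow>\<^sub>M M" and distr_\<pi>: "distr N M \<pi> = M"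
    and e [measurable]: "e \<in> borel_measurable N" and e_in: "\<And>x. x \<in> space N \<Longrightarrow> e x \<in> L2_power a b"
    and distr_e: "distr N borel e = distr M borel \<epsilon>"
    and indep: "prob_space.indep_var N borel e borel (\<lambda>x. B (\<pi> x))"
    using ext by (auto simp: noise_extension_def)
  interpret M: prob_space M by fact
  interpret N: prob_space N by fact
  have L: "bounded_linear L" unfolding L_def by (rule bounded_linear_prediction_error_op[OF S \<beta>])
  have [measurable]: "L \<in> borel_measurable borel" by (rule borel_measurable_bounded_linear[OF L])
  have [measurable]: "B \<in> borel_measurable M" "\<epsilon> \<in> borel_measurable M"
    using B \<epsilon> by (auto simp: shift_space_def)
  let ?X = "\<lambda>x. L (B (\<pi> x))" and ?Y = "\<lambda>x. L (e x)"

  have LB: "finite_second_moment M (\<lambda>w. L (B w))" and L\<epsilon>: "finite_second_moment M (\<lambda>w. L (\<epsilon> w))"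
    using finite_second_moment_bounded_linear[OF L finite_second_moment_shift[OF M]] B \<epsilon> by auto
  have X_moment: "(\<integral>x. (norm (?X x))\<^sup>2 \<partial>N) = (\<integral>w. (norm (L (B w)))\<^sup>2 \<partial>M)"
    using integral_distr[OF \<pi>, of "\<lambda>w. (norm (L (B w)))\<^sup>2"] by (simp add: distr_\<pi>)
  have X: "finite_second_moment N ?X"
    using LB integrable_distr_eq[OF \<pi>, of "\<lambda>w. (norm (L (B w)))\<^sup>2"]
    by (simp add: finite_second_moment_def distr_\<pi>)
  have transfer: "(\<integral>x. h (e x) \<partial>N) = (\<integral>w. h (\<epsilon> w) \<partial>M)" "integrable N (\<lambda>x. h (e x)) = integrable M (\<lambda>w. h (\<epsilon> w))"
    if [measurable]: "h \<in> borel_measurable borel" for h :: "L2 ^ ('p option) \<Rightarrow> 'c::{banach, second_countable_topology}"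
    using integral_distr[of e N borel h] integral_distr[of \<epsilon> M borel h]
      integrable_distr_eq[of e N borel h] integrable_distr_eq[of \<epsilon> M borel h] by (simp_all add: distr_e)
  have Y_moment: "(\<integral>x. (norm (?Y x))\<^sup>2 \<partial>N) = (\<integral>w. (norm (L (\<epsilon> w)))\<^sup>2 \<partial>M)"
    by (rule transfer) measurable
  have Y: "finite_second_moment N ?Y"
    using L\<epsilon> transfer(2)[of "\<lambda>u. (norm (L u))\<^sup>2"] by (simp add: finite_second_moment_def)
  have "N.expectation ?Y = M.expectation (\<lambda>w. L (\<epsilon> w))"
    by (rule transfer) measurable
  also have "\<dots> = L 0"
    using has_bochner_integral_bounded_linear[OF L mean] by (rule has_bochner_integral_integral_eq)
  also have "\<dots> = 0" by (rule linear_0[OF bounded_linear.linear[OF L]])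
  finally have Y_mean: "N.expectation ?Y = 0" .
  have "N.indep_var borel (L \<circ> e) borel (L \<circ> (\<lambda>x. B (\<pi> x)))"
    by (rule N.indep_var_compose[OF indep]) measurable
  then have "N.expectation (\<lambda>x. ?Y x \<bullet> ?X x) = 0"
    using X Y Y_mean by (intro N.expectation_inner_indep_centred) (auto simp: comp_def)
  then have cross: "N.expectation (\<lambda>x. ?X x \<bullet> ?Y x) = 0"
    by (simp add: inner_commute)

  have "risk a b S N (\<lambda>x. B (\<pi> x)) e \<beta> = (\<integral>x. (norm (residual_op a b \<beta> (S (B (\<pi> x) + e x))))\<^sup>2 \<partial>N)"
    unfolding risk_def norm_residual_op_sq[OF \<beta>] ..
  also have "\<dots> = (\<integral>x. (norm (?X x + ?Y x))\<^sup>2 \<partial>N)"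
  proof (intro Bochner_Integration.integral_cong refl)
    fix x assume x: "x \<in> space N"
    then have "B (\<pi> x) \<in> L2_power a b"
      using measurable_space[OF \<pi>] B by (simp add: shift_space_def)
    then have "residual_op a b \<beta> (S (B (\<pi> x) + e x)) = L (B (\<pi> x) + e x)"
      using e_in[OF x] by (simp add: L_def prediction_error_op_def L2_vec_restrict_eq_self L2_power_add)
    then show "(norm (residual_op a b \<beta> (S (B (\<pi> x) + e x))))\<^sup>2 = (norm (?X x + ?Y x))\<^sup>2"
      by (simp add: linear_add[OF bounded_linear.linear[OF L]])
  qed
  also have "\<dots> = (\<integral>w. (norm (L (B w)))\<^sup>2 \<partial>M) + (\<integral>w. (norm (L (\<epsilon> w)))\<^sup>2 \<partial>M)"
    unfolding integral_norm_add_sq[OF X Y] cross X_moment Y_moment by simp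
  finally show ?thesis .
qed

section \<open>Worst-case risk\<close>

text \<open>
  Admissibility constrains directions \<open>g\<close> in \<open>L2_power a b\<close> only. This covers every \<open>g\<close>: shifts take
  values in that subspace, so they do not see the part of \<open>g\<close> orthogonal to it.
\<close>

lemma admissible_second_moment_le:
  fixes A A' :: "'w \<Rightarrow> L2 ^ 'n" and L :: "L2 ^ 'n \<Rightarrow> 'b::{real_inner, second_countable_topology}"
  assumes M: "prob_space M" and \<A>: "\<A> \<subseteq> shift_space a b M"
    and A: "A \<in> shift_space a b M" and A': "A' \<in> admissible_shifts a b M \<gamma> \<A> A"
    and L: "bounded_linear L"
  shows "(\<integral>w. (norm (L (A' w)))\<^sup>2 \<partial>M) \<le> \<gamma> * (\<integral>w. (norm (L (A w)))\<^sup>2 \<partial>M)"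
proof -
  have A'_in: "A' \<in> shift_space a b M" using A' \<A> by (auto simp: admissible_shifts_def)
  have form: "(\<integral>w. (U w \<bullet> g)\<^sup>2 \<partial>M) = shift_form a b M U (L2_vec_restrict {a..b} g)"
    if U: "U \<in> shift_space a b M" for U :: "'w \<Rightarrow> L2 ^ 'n" and g
  proof -
    have "U w \<bullet> g = U w \<bullet> L2_vec_restrict {a..b} g" if "w \<in> space M" for w
      using U that inner_L2_vec_restrict_commute[of "{a..b}" "U w" g]
      by (simp add: shift_space_def L2_vec_restrict_eq_self)
    then show ?thesis unfolding shift_form_eq[OF M U]
      by (intro Bochner_Integration.integral_cong) auto
  qed
  show ?thesis
  proof (rule dominated_second_moments[OF finite_second_moment_shift[OF M A'_in] finite_second_moment_shift[OF M A] _ L])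
    show "(\<integral>w. (A' w \<bullet> g)\<^sup>2 \<partial>M) \<le> \<gamma> * (\<integral>w. (A w \<bullet> g)\<^sup>2 \<partial>M)" for g
      unfolding form[OF A'_in] form[OF A]
      using A' L2_vec_restrict_in_power[of a b g] by (simp add: admissible_shifts_def)
  qed
qed

text \<open>
  From \<open>- 2 \<langle>X, Y - X\<rangle> \<le> r \<parallel>X\<parallel>\<^sup>2 + \<parallel>Y - X\<parallel>\<^sup>2 / r\<close>: this weighting of the cross term makes both error terms of
  order \<open>r\<close>.
\<close>

lemma second_moment_le_perturbed:
  fixes X Y :: "'w \<Rightarrow> 'a::{real_inner, second_countable_topology}"
  assumes X: "finite_second_moment M X" and Y: "finite_second_moment M Y" and "0 < r"
    and close: "(\<integral>w. (norm (Y w - X w))\<^sup>2 \<partial>M) \<le> r\<^sup>2"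
  shows "(\<integral>w. (norm (X w))\<^sup>2 \<partial>M) \<le> (\<integral>w. (norm (Y w))\<^sup>2 \<partial>M) + r * ((\<integral>w. (norm (X w))\<^sup>2 \<partial>M) + 1)"
proof -
  have D: "finite_second_moment M (\<lambda>w. Y w - X w)" by (rule finite_second_moment_diff[OF Y X])
  have pointwise: "(norm x)\<^sup>2 \<le> (norm y)\<^sup>2 + r * (norm x)\<^sup>2 + (norm (y - x))\<^sup>2 / r" for x y :: 'a
  proof -
    have "(norm y)\<^sup>2 = (norm x)\<^sup>2 + 2 * (x \<bullet> (y - x)) + (norm (y - x))\<^sup>2"
      by (simp add: power2_norm_eq_inner inner_diff inner_commute)
    moreover have "- (2 * (x \<bullet> (y - x))) \<le> r * (norm x)\<^sup>2 + (norm (y - x))\<^sup>2 / r"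
    proof -
      have "- (2 * (x \<bullet> (y - x))) \<le> 2 * (sqrt r * norm x) * (norm (y - x) / sqrt r)"
        using Cauchy_Schwarz_ineq2[of x "y - x"] \<open>0 < r\<close> by simp
      also have "\<dots> \<le> (sqrt r * norm x)\<^sup>2 + (norm (y - x) / sqrt r)\<^sup>2"
        by (rule sum_squares_bound)
      finally show ?thesis using \<open>0 < r\<close> by (simp add: power_mult_distrib power_divide)
    qed
    moreover have "0 \<le> (norm (y - x))\<^sup>2" by simp
    ultimately show ?thesis by linarith
  qed
  have "(\<integral>w. (norm (X w))\<^sup>2 \<partial>M) \<le> (\<integral>w. (norm (Y w))\<^sup>2 + r * (norm (X w))\<^sup>2 + (norm (Y w - X w))\<^sup>2 / r \<partial>M)"
    using X Y D by (intro integral_mono pointwise) (auto simp: finite_second_moment_def)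
  also have "\<dots> = (\<integral>w. (norm (Y w))\<^sup>2 \<partial>M) + r * (\<integral>w. (norm (X w))\<^sup>2 \<partial>M) + (\<integral>w. (norm (Y w - X w))\<^sup>2 \<partial>M) / r"
    using X Y D by (simp add: finite_second_moment_def)
  also have "(\<integral>w. (norm (Y w - X w))\<^sup>2 \<partial>M) / r \<le> r"
    using close \<open>0 < r\<close> by (simp add: divide_le_eq power2_eq_square)
  finally show ?thesis by (simp add: distrib_left)
qed

text \<open>
  A bounded linear map multiplies the distance of two shifts by at most its bound \<open>K\<close>, so a shift
  within \<open>r / K\<close> of \<open>U\<close> has an image within \<open>r\<close> of that of \<open>U\<close>, where the second moment is almost as large.
\<close>

lemma shift_closure_second_moment:
  fixes U :: "'w \<Rightarrow> L2 ^ 'n" and L :: "L2 ^ 'n \<Rightarrow> 'b::{real_inner, second_countable_topology}"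
  assumes M: "prob_space M" and C: "C \<subseteq> shift_space a b M" and U: "U \<in> shift_closure a b M C"
    and L: "bounded_linear L" and "0 < \<delta>"
  shows "\<exists>W\<in>C. (\<integral>w. (norm (L (U w)))\<^sup>2 \<partial>M) \<le> (\<integral>w. (norm (L (W w)))\<^sup>2 \<partial>M) + \<delta>"
proof -
  define m where "m = (\<integral>w. (norm (L (U w)))\<^sup>2 \<partial>M)"
  have "0 \<le> m" by (simp add: m_def)
  \<comment> \<open>The tolerance for which \<open>second_moment_le_perturbed\<close> loses exactly \<open>\<delta>\<close>.\<close>
  define r where "r = \<delta> / (m + 1)"
  have r: "0 < r" "r * (m + 1) = \<delta>" using \<open>0 \<le> m\<close> \<open>0 < \<delta>\<close> by (auto simp: r_def)
  obtain K where K: "0 < K" "\<And>x. norm (L x) \<le> norm x * K"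
    using bounded_linear.pos_bounded[OF L] by blast
  have U_in: "U \<in> shift_space a b M" using U by (simp add: shift_closure_def)
  obtain W where W: "W \<in> C" "sqrt (enn2real (shift_norm_sq a b M (\<lambda>w. W w - U w))) < r / K"
    using U divide_pos_pos[OF r(1) K(1)] unfolding shift_closure_def by blast
  have W_in: "W \<in> shift_space a b M" using W C by auto
  note Us = finite_second_moment_shift[OF M U_in] and Ws = finite_second_moment_shift[OF M W_in]
  have D: "finite_second_moment M (\<lambda>w. W w - U w)" by (rule finite_second_moment_diff[OF Ws Us])
  have "W w - U w \<in> L2_power a b" if "w \<in> space M" for w
    using L2_power_add[of "W w" a b "(-1) *\<^sub>R U w"] L2_power_scaleR[of "U w" a b "-1"] U_in W_in that
    by (simp add: shift_space_def)
  then have "shift_norm_sq a b M (\<lambda>w. W w - U w) = (\<integral>\<^sup>+w. ennreal ((norm (W w - U w))\<^sup>2) \<partial>M)"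
    using D by (intro shift_norm_sq_eq[OF M]) (auto simp: finite_second_moment_def)
  also have "\<dots> = ennreal (\<integral>w. (norm (W w - U w))\<^sup>2 \<partial>M)"
    using D by (intro nn_integral_eq_integral) (auto simp: finite_second_moment_def)
  finally have "sqrt (\<integral>w. (norm (W w - U w))\<^sup>2 \<partial>M) < r / K"
    using W(2) by simp
  from power_strict_mono[OF this, of 2] have "(\<integral>w. (norm (W w - U w))\<^sup>2 \<partial>M) < (r / K)\<^sup>2"
    by simp
  then have close: "K\<^sup>2 * (\<integral>w. (norm (W w - U w))\<^sup>2 \<partial>M) \<le> r\<^sup>2"
    using K(1) by (simp add: power_divide field_simps)
  have "(\<integral>w. (norm (L (W w) - L (U w)))\<^sup>2 \<partial>M) \<le> (\<integral>w. K\<^sup>2 * (norm (W w - U w))\<^sup>2 \<partial>M)"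
  proof (rule integral_mono)
    fix w
    have "norm (L (W w) - L (U w)) \<le> norm (W w - U w) * K"
      using K(2)[of "W w - U w"] by (simp add: linear_diff[OF bounded_linear.linear[OF L]])
    from power_mono[OF this, of 2]
    show "(norm (L (W w) - L (U w)))\<^sup>2 \<le> K\<^sup>2 * (norm (W w - U w))\<^sup>2"
      by (simp add: power_mult_distrib mult.commute)
  qed (use D finite_second_moment_diff[OF finite_second_moment_bounded_linear[OF L Ws] finite_second_moment_bounded_linear[OF L Us]]
      in \<open>auto simp: finite_second_moment_def\<close>)
  also have "\<dots> \<le> r\<^sup>2" using close by simp
  finally have "m \<le> (\<integral>w. (norm (L (W w)))\<^sup>2 \<partial>M) + r * (m + 1)"
    unfolding m_def
    by (intro second_moment_le_perturbed finite_second_moment_bounded_linear[OF L Us]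
        finite_second_moment_bounded_linear[OF L Ws] r(1))
  then have "m \<le> (\<integral>w. (norm (L (W w)))\<^sup>2 \<partial>M) + \<delta>" by (simp only: r(2))
  with W(1) show ?thesis unfolding m_def by blast
qed

text \<open>The observational environment has zero shift; this makes \<open>risk_eq\<close> applicable to it.\<close>

lemma zero_in_shift_space:
  assumes "prob_space M"
  shows "(\<lambda>w. 0 :: L2 ^ 'n) \<in> shift_space a b M"
proof -
  have 0: "(0 :: L2 ^ 'n) \<in> L2_power a b"
    using L2_power_scaleR[OF L2_vec_restrict_in_power, of 0] by simp
  then have "shift_norm_sq a b M (\<lambda>w. 0 :: L2 ^ 'n) = 0"
    using shift_norm_sq_eq[OF assms, of "\<lambda>w. 0 :: L2 ^ 'n" a b] by simp
  with 0 show ?thesis by (simp add: shift_space_def)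
qed

theorem theorem3p7:
  fixes T\<^sub>1 T\<^sub>2 \<gamma> :: real
    and M :: "'w measure"
    and D :: "(L2 ^ ('p::finite option)) set"
    and T S :: "L2 ^ ('p option) \<Rightarrow> L2 ^ ('p option)"
    and \<epsilon> A :: "'w \<Rightarrow> L2 ^ ('p option)"
    and \<A> :: "('w \<Rightarrow> L2 ^ ('p option)) set"
    and N :: "('w \<Rightarrow> L2 ^ ('p option)) \<Rightarrow> 'e measure"
    and \<pi> :: "('w \<Rightarrow> L2 ^ ('p option)) \<Rightarrow> 'e \<Rightarrow> 'w"
    and e :: "('w \<Rightarrow> L2 ^ ('p option)) \<Rightarrow> 'e \<Rightarrow> L2 ^ ('p option)"
    and R :: "('w \<Rightarrow> L2 ^ ('p option)) \<Rightarrow> ('p \<Rightarrow> real \<times> real \<Rightarrow> real) \<Rightarrow> real"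
    and \<beta> :: "'p \<Rightarrow> real \<times> real \<Rightarrow> real"
  assumes "T\<^sub>1 < T\<^sub>2"
    and "prob_space M"
    and "solution_operator T\<^sub>1 T\<^sub>2 D T S"
    and "\<epsilon> \<in> shift_space T\<^sub>1 T\<^sub>2 M"
    and "measure M {\<omega>\<in>space M. \<epsilon> \<omega> \<in> range_I_minus D T} = 1"
    and "has_bochner_integral M \<epsilon> 0"
    and "\<And>B. B \<in> shift_space T\<^sub>1 T\<^sub>2 M \<Longrightarrow> noise_extension T\<^sub>1 T\<^sub>2 M \<epsilon> B (N B) (\<pi> B) (e B)"
    and "\<And>B b. R B b = risk T\<^sub>1 T\<^sub>2 S (N B) (\<lambda>x. B (\<pi> B x)) (e B) b"
    and "A \<in> shift_space T\<^sub>1 T\<^sub>2 M"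
    and "0 < \<gamma>"
    and "\<A> \<subseteq> shift_space T\<^sub>1 T\<^sub>2 M"
    and "(\<lambda>\<omega>. sqrt \<gamma> *\<^sub>R A \<omega>) \<in> shift_closure T\<^sub>1 T\<^sub>2 M (admissible_shifts T\<^sub>1 T\<^sub>2 M \<gamma> \<A> A)"
    and "\<And>i. \<beta> i \<in> L2_square T\<^sub>1 T\<^sub>2"
  shows "(SUP A'\<in>admissible_shifts T\<^sub>1 T\<^sub>2 M \<gamma> \<A> A. ereal (R A' \<beta>)) =
    ereal (1/2 * (R A \<beta> + R (\<lambda>\<omega>. 0) \<beta>) + (\<gamma> - 1/2) * (R A \<beta> - R (\<lambda>\<omega>. 0) \<beta>))"
proof -
  note M = assms(2) and \<epsilon> = assms(4) and A = assms(9) and \<beta> = assms(13)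
  have S: "bounded_linear_on (L2_power T\<^sub>1 T\<^sub>2) S"
    using assms(3) by (simp add: solution_operator_def)
  define L where "L = prediction_error_op T\<^sub>1 T\<^sub>2 S \<beta>"
  have L: "bounded_linear L"
    unfolding L_def by (rule bounded_linear_prediction_error_op[OF S \<beta>])
  define m where "m B = (\<integral>\<omega>. (norm (L (B \<omega>)))\<^sup>2 \<partial>M)" for B
  let ?C = "admissible_shifts T\<^sub>1 T\<^sub>2 M \<gamma> \<A> A"
  have R_eq: "R B \<beta> = m B + m \<epsilon>" if "B \<in> shift_space T\<^sub>1 T\<^sub>2 M" for B
    unfolding assms(8) m_def L_def by (rule risk_eq[OF M assms(7)[OF that] that \<epsilon> assms(6) S \<beta>])
  have C: "?C \<subseteq> shift_space T\<^sub>1 T\<^sub>2 M"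
    using assms(11) by (auto simp: admissible_shifts_def)
  have "m (\<lambda>\<omega>. 0) = 0"
    by (simp add: m_def linear_0[OF bounded_linear.linear[OF L]])
  then have rhs: "1/2 * (R A \<beta> + R (\<lambda>\<omega>. 0) \<beta>) + (\<gamma> - 1/2) * (R A \<beta> - R (\<lambda>\<omega>. 0) \<beta>) = \<gamma> * m A + m \<epsilon>"
    by (simp add: R_eq[OF A] R_eq[OF zero_in_shift_space[OF M]] algebra_simps)
  have scaled: "m (\<lambda>\<omega>. sqrt \<gamma> *\<^sub>R A \<omega>) = \<gamma> * m A"
    using assms(10)
    by (simp add: m_def linear_scale[OF bounded_linear.linear[OF L]] power_mult_distrib)
  show ?thesis
    unfolding rhs
  proof (rule antisym)
    show "(SUP A'\<in>?C. ereal (R A' \<beta>)) \<le> ereal (\<gamma> * m A + m \<epsilon>)"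
    proof (rule SUP_least)
      fix A' assume A': "A' \<in> ?C"
      then have "m A' \<le> \<gamma> * m A"
        unfolding m_def by (rule admissible_second_moment_le[OF M assms(11) A _ L])
      moreover have "R A' \<beta> = m A' + m \<epsilon>" using A' C by (intro R_eq) blast
      ultimately show "ereal (R A' \<beta>) \<le> ereal (\<gamma> * m A + m \<epsilon>)" by simp
    qed
    show "ereal (\<gamma> * m A + m \<epsilon>) \<le> (SUP A'\<in>?C. ereal (R A' \<beta>))"
    proof (rule ereal_le_epsilon2)
      fix \<delta> :: real assume "0 < \<delta>"
      then have "\<exists>W\<in>?C. m (\<lambda>\<omega>. sqrt \<gamma> *\<^sub>R A \<omega>) \<le> m W + \<delta>"
        unfolding m_def by (rule shift_closure_second_moment[OF M C assms(12) L])
      then obtain W where W: "W \<in> ?C" "\<gamma> * m A \<le> m W + \<delta>"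
        unfolding scaled by blast
      have "R W \<beta> = m W + m \<epsilon>" using W(1) C by (intro R_eq) blast
      with W(2) have "ereal (\<gamma> * m A + m \<epsilon>) \<le> ereal (R W \<beta>) + ereal \<delta>" by simp
      also have "\<dots> \<le> (SUP A'\<in>?C. ereal (R A' \<beta>)) + ereal \<delta>"
        by (intro add_right_mono SUP_upper W(1))
      finally show "ereal (\<gamma> * m A + m \<epsilon>) \<le> (SUP A'\<in>?C. ereal (R A' \<beta>)) + ereal \<delta>" .
    qed
  qed
qed

end
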